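(* Let $(V,d)$ be the domain complex of a closed Hilbert complex $(W,d)$ satisfying the compactness property, and let $(V_h,d)$ be a family of finite-dimensional subcomplexes parametrized by $h$ and admitting uniformly $W$-bounded cochain projections $\pi_h$. Fix $k$ and $f\in W^k$. Let $(\sigma,u,p)\in V^{k-1}\times V^k\times\mathfrak H^k$ be the solution of $$\begin{aligned}\langle\sigma,\tau\rangle-\langle d\tau,u\rangle&=0, &&\tau\in V^{k-1},\\ \langle d\sigma,v\rangle+\langle du,dv\rangle+\langle v,p\rangle&=\langle f,v\rangle, &&v\in V^k,\\ \langle u,q\rangle&=0,&&q\in\mathfrak H^k,\end{aligned}$$ and let $(\sigma_h,u_h,p_h)\in V_h^{k-1}\times V_h^k\times\mathfrak H_h^k$ be the solution of the same system with $V^{k-1},V^k,\mathfrak H^k$ replaced by $V_h^{k-1},V_h^k,\mathfrak H_h^k$. Then for some constant $C$ independent of $h$ and $(\sigma,u,p)$, $$\|d(\sigma-\sigma_h)\|\le CE(d\sigma),$$ $$\|\sigma-\sigma_h\|\le C[E(\sigma)+\eta E(d\sigma)],$$ $$\|p-p_h\|\le C[E(p)+\mu E(d\sigma)],$$ $$\|d(u-u_h)\|\le C\bigl(E(du)+\eta[E(d\sigma)+E(p)]\bigr),$$ $$\|u-u_h\|\le C\bigl(E(u)+\eta[E(du)+E(\sigma)]+(\eta^2+\delta)[E(d\sigma)+E(p)]+\mu E(P_{\mathfrak B}u)\bigr).$$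
   Context: A Hilbert complex $(W,d)$ is a finite sequence of real Hilbert spaces $W^k$ and closed, densely defined operators $d^k$ from $W^k$ to $W^{k+1}$ such that the range of $d^k$ lies in the domain of $d^{k+1}$ and $d^{k+1}\circ d^k=0$; it is closed if every $d^k$ has closed range. The domain complex $(V,d)$ has $V^k=$ domain of $d^k$ with the graph inner product $\langle u,v\rangle_V=\langle u,v\rangle_{W^k}+\langle d^ku,d^kv\rangle_{W^{k+1}}$. Unsubscripted $\langle\cdot,\cdot\rangle$, $\|\cdot\|$ are those of $W^k$. $d^*$ (from $W^k$ to $W^{k-1}$) is the Hilbert space adjoint of $d^{k-1}$, with domain $V_k^*$. The compactness property: for each $k$, $V^k\cap V_k^*$ (normed by $\|v\|_V^2+\|v\|^2+\|d^*v\|^2$) is dense in $W^k$ and compactly included in it. $\mathfrak Z^k=\ker d^k$, $\mathfrak B^k=$ range of $d^{k-1}$, $\mathfrak H^k=\mathfrak Z^k\cap(\mathfrak B^k)^\perp$; $P_{\mathfrak B}$, $P_{\mathfrak H}$ are the $W^k$-orthogonal projections onto $\mathfrak B^k$, $\mathfrak H^k$. $K:W^k\to W^k$ is the solution operator $Kf=u$, where $u$ is the second component of the solution of the (continuous) system in the claim with data $f$. A subcomplex consists of subspaces $V_h^k\subset V^k$ with $dV_h^k\subset V_h^{k+1}$; $\mathfrak Z_h^k=\ker(d|_{V_h^k})$, $\mathfrak B_h^k=dV_h^{k-1}$, $\mathfrak H_h^k=\mathfrak Z_h^k\cap(\mathfrak B_h^k)^\perp$. Uniformly $W$-bounded cochain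 projections are linear maps $\pi_h^k:W^k\to V_h^k$, bounded in $\mathcal L(W^k,W^k)$ uniformly in $h$, restricting to the identity on $V_h^k$, with $d\pi_h^k=\pi_h^{k+1}d$ on $V^k$. Put $$\delta=\|(I-\pi_h)K\|_{\mathcal L(W^k,W^k)},\qquad\mu=\|(I-\pi_h)P_{\mathfrak H}\|_{\mathcal L(W^k,W^k)},$$ $$\eta=\max_{j=0,1}\bigl[\|(I-\pi_h)dK\|_{\mathcal L(W^{k-j},W^{k-j+1})},\ \|(I-\pi_h)d^*K\|_{\mathcal L(W^{k+j},W^{k+j-1})}\bigr],$$ where $K$ is the solution operator in the degree of its argument, and for $w\in W^j$ let $E(w)=\inf_{v\in V_h^j}\|w-v\|$. *)

theory Defs
  imports "HOL-Analysis.Analysis"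
begin

text \<open>
  The spaces of a Hilbert complex are complete subspaces \<open>W k\<close> of one ambient real inner product
  space \<open>'a\<close>.  This is no restriction, since any finite sequence of Hilbert spaces embeds in its
  direct sum; no relation between different \<open>W k\<close> is assumed.  Degrees are integers, with
  \<open>W k = {0}\<close> outside a finite range, so that degrees \<open>-1\<close> and \<open>n + 1\<close> need no special treatment.
  The operator \<open>d k\<close> is a total function, constrained only on its domain \<open>V k\<close>.
\<close>

definition lin_on :: "'a::real_vector set \<Rightarrow> ('a \<Rightarrow> 'b::real_vector) \<Rightarrow> bool" where
  "lin_on S f \<longleftrightarrow>
    (\<forall>x\<in>S. \<forall>y\<in>S. f (x + y) = f x + f y) \<and> (\<forall>c. \<forall>x\<in>S. f (c *\<^sub>R x) = c *\<^sub>R f x)"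

locale hilbert_complex =
  fixes W V :: "int \<Rightarrow> 'a::real_inner set" and d :: "int \<Rightarrow> 'a \<Rightarrow> 'a"
  assumes finite_length: "\<exists>n. \<forall>k. k \<notin> {0..n} \<longrightarrow> W k = {0}"
    and subspace_W: "subspace (W k)"
    and complete_W: "complete (W k)"
    and subspace_V: "subspace (V k)"
    and V_subset: "V k \<subseteq> W k"
    and V_dense: "W k \<subseteq> closure (V k)"
    and d_linear: "lin_on (V k) (d k)"
    and d_in_W: "v \<in> V k \<Longrightarrow> d k v \<in> W (k + 1)"
    and d_closed: "closed ((\<lambda>v. (v, d k v)) ` V k)"
    and d_range: "v \<in> V k \<Longrightarrow> d k v \<in> V (k + 1)"
    and d_d: "v \<in> V k \<Longrightarrow> d (k + 1) (d k v) = 0"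

locale closed_hilbert_complex = hilbert_complex +
  assumes closed_range: "closed (d k ` V k)"

text \<open>The following apply both to the domain complex and to a subcomplex \<open>Vh\<close> in place of \<open>V\<close>.\<close>

definition cocycles :: "(int \<Rightarrow> 'a::real_inner set) \<Rightarrow> (int \<Rightarrow> 'a \<Rightarrow> 'a) \<Rightarrow> int \<Rightarrow> 'a set" where
  "cocycles V d k = {v \<in> V k. d k v = 0}"

definition coboundaries :: "(int \<Rightarrow> 'a::real_inner set) \<Rightarrow> (int \<Rightarrow> 'a \<Rightarrow> 'a) \<Rightarrow> int \<Rightarrow> 'a set" where
  "coboundaries V d k = d (k - 1) ` V (k - 1)"

definition harmonics :: "(int \<Rightarrow> 'a::real_inner set) \<Rightarrow> (int \<Rightarrow> 'a \<Rightarrow> 'a) \<Rightarrow> int \<Rightarrow> 'a set" where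
  "harmonics V d k = cocycles V d k \<inter> (coboundaries V d k)\<^sup>\<bottom>"

definition mixed_solution ::
  "(int \<Rightarrow> 'a::real_inner set) \<Rightarrow> (int \<Rightarrow> 'a \<Rightarrow> 'a) \<Rightarrow> int \<Rightarrow> 'a \<Rightarrow> 'a \<Rightarrow> 'a \<Rightarrow> 'a \<Rightarrow> bool" where
  "mixed_solution V d k f \<sigma> u p \<longleftrightarrow>
    \<sigma> \<in> V (k - 1) \<and> u \<in> V k \<and> p \<in> harmonics V d k \<and>
    (\<forall>\<tau>\<in>V (k - 1). inner \<sigma> \<tau> - inner (d (k - 1) \<tau>) u = 0) \<and>
    (\<forall>v\<in>V k. inner (d (k - 1) \<sigma>) v + inner (d k u) (d k v) + inner v p = inner f v) \<and>
    (\<forall>q\<in>harmonics V d k. inner u q = 0)"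

text \<open>\<open>adj_dom W V d k\<close> is the domain of the adjoint \<open>adj W V d k\<close> of \<open>d (k - 1)\<close>.\<close>

definition adj_dom ::
  "(int \<Rightarrow> 'a::real_inner set) \<Rightarrow> (int \<Rightarrow> 'a set) \<Rightarrow> (int \<Rightarrow> 'a \<Rightarrow> 'a) \<Rightarrow> int \<Rightarrow> 'a set" where
  "adj_dom W V d k =
    {u \<in> W k. \<exists>w\<in>W (k - 1). \<forall>v\<in>V (k - 1). inner (d (k - 1) v) u = inner v w}"

definition adj ::
  "(int \<Rightarrow> 'a::real_inner set) \<Rightarrow> (int \<Rightarrow> 'a set) \<Rightarrow> (int \<Rightarrow> 'a \<Rightarrow> 'a) \<Rightarrow> int \<Rightarrow> 'a \<Rightarrow> 'a" where
  "adj W V d k u =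
    (THE w. w \<in> W (k - 1) \<and> (\<forall>v\<in>V (k - 1). inner (d (k - 1) v) u = inner v w))"

text \<open>
  Compact inclusion: the unit ball of \<open>V k \<inter> adj_dom W V d k\<close>, with respect to the norm whose square
  is the graph norm squared of \<open>d\<close> plus the graph norm squared of the adjoint, is relatively compact.
\<close>

definition compactness_property ::
  "(int \<Rightarrow> 'a::real_inner set) \<Rightarrow> (int \<Rightarrow> 'a set) \<Rightarrow> (int \<Rightarrow> 'a \<Rightarrow> 'a) \<Rightarrow> bool" where
  "compactness_property W V d \<longleftrightarrow> (\<forall>k.
    W k \<subseteq> closure (V k \<inter> adj_dom W V d k) \<and>
    compact (closure {v \<in> V k \<inter> adj_dom W V d k.
      ((norm v)\<^sup>2 + (norm (d k v))\<^sup>2) + (norm v)\<^sup>2 + (norm (adj W V d k v))\<^sup>2 \<le> 1}))"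

definition solution_op ::
  "(int \<Rightarrow> 'a::real_inner set) \<Rightarrow> (int \<Rightarrow> 'a \<Rightarrow> 'a) \<Rightarrow> int \<Rightarrow> 'a \<Rightarrow> 'a" where
  "solution_op V d k f = (THE u. \<exists>\<sigma> p. mixed_solution V d k f \<sigma> u p)"

definition finite_dim_subcomplex ::
  "(int \<Rightarrow> 'a::real_inner set) \<Rightarrow> (int \<Rightarrow> 'a \<Rightarrow> 'a) \<Rightarrow> (int \<Rightarrow> 'a set) \<Rightarrow> bool" where
  "finite_dim_subcomplex V d Vh \<longleftrightarrow> (\<forall>k.
    (\<exists>B. finite B \<and> Vh k = span B) \<and> Vh k \<subseteq> V k \<and> d k ` Vh k \<subseteq> Vh (k + 1))"

definition bounded_cochain_projections ::
  "(int \<Rightarrow> 'a::real_inner set) \<Rightarrow> (int \<Rightarrow> 'a set) \<Rightarrow> (int \<Rightarrow> 'a \<Rightarrow> 'a) \<Rightarrow>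
    ('h \<Rightarrow> int \<Rightarrow> 'a set) \<Rightarrow> ('h \<Rightarrow> int \<Rightarrow> 'a \<Rightarrow> 'a) \<Rightarrow> bool" where
  "bounded_cochain_projections W V d Vh \<pi> \<longleftrightarrow> (\<forall>k.
    (\<forall>h. lin_on (W k) (\<pi> h k)) \<and>
    (\<forall>h. \<forall>w\<in>W k. \<pi> h k w \<in> Vh h k) \<and>
    (\<exists>M. \<forall>h. \<forall>w\<in>W k. norm (\<pi> h k w) \<le> M * norm w) \<and>
    (\<forall>h. \<forall>v\<in>Vh h k. \<pi> h k v = v) \<and>
    (\<forall>h. \<forall>v\<in>V k. d k (\<pi> h k v) = \<pi> h (k + 1) (d k v)))"

definition orth_proj :: "'a::real_inner set \<Rightarrow> 'a \<Rightarrow> 'a" where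
  "orth_proj S x = (THE y. y \<in> S \<and> x - y \<in> S\<^sup>\<bottom>)"

text \<open>Operator norm of an operator defined on the subspace \<open>S\<close>; compare \<open>onorm\<close>.\<close>

definition onorm_on :: "'a::real_normed_vector set \<Rightarrow> ('a \<Rightarrow> 'b::real_normed_vector) \<Rightarrow> real" where
  "onorm_on S T = (SUP x\<in>S. norm (T x) / norm x)"

text \<open>
  In the remaining definitions \<open>\<pi> k\<close> is the projection onto the discrete space of degree \<open>k\<close>,
  for one fixed value of the discretization parameter.
\<close>

definition delta ::
  "(int \<Rightarrow> 'a::real_inner set) \<Rightarrow> (int \<Rightarrow> 'a set) \<Rightarrow> (int \<Rightarrow> 'a \<Rightarrow> 'a) \<Rightarrow>
    (int \<Rightarrow> 'a \<Rightarrow> 'a) \<Rightarrow> int \<Rightarrow> real" where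
  "delta W V d \<pi> k = onorm_on (W k) (\<lambda>f. solution_op V d k f - \<pi> k (solution_op V d k f))"

definition mu ::
  "(int \<Rightarrow> 'a::real_inner set) \<Rightarrow> (int \<Rightarrow> 'a set) \<Rightarrow> (int \<Rightarrow> 'a \<Rightarrow> 'a) \<Rightarrow>
    (int \<Rightarrow> 'a \<Rightarrow> 'a) \<Rightarrow> int \<Rightarrow> real" where
  "mu W V d \<pi> k = onorm_on (W k)
    (\<lambda>f. orth_proj (harmonics V d k) f - \<pi> k (orth_proj (harmonics V d k) f))"

definition d_solution_error ::
  "(int \<Rightarrow> 'a::real_inner set) \<Rightarrow> (int \<Rightarrow> 'a set) \<Rightarrow> (int \<Rightarrow> 'a \<Rightarrow> 'a) \<Rightarrow>
    (int \<Rightarrow> 'a \<Rightarrow> 'a) \<Rightarrow> int \<Rightarrow> real" where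
  "d_solution_error W V d \<pi> k = onorm_on (W k)
    (\<lambda>f. d k (solution_op V d k f) - \<pi> (k + 1) (d k (solution_op V d k f)))"

definition adj_solution_error ::
  "(int \<Rightarrow> 'a::real_inner set) \<Rightarrow> (int \<Rightarrow> 'a set) \<Rightarrow> (int \<Rightarrow> 'a \<Rightarrow> 'a) \<Rightarrow>
    (int \<Rightarrow> 'a \<Rightarrow> 'a) \<Rightarrow> int \<Rightarrow> real" where
  "adj_solution_error W V d \<pi> k = onorm_on (W k)
    (\<lambda>f. adj W V d k (solution_op V d k f) - \<pi> (k - 1) (adj W V d k (solution_op V d k f)))"

definition eta ::
  "(int \<Rightarrow> 'a::real_inner set) \<Rightarrow> (int \<Rightarrow> 'a set) \<Rightarrow> (int \<Rightarrow> 'a \<Rightarrow> 'a) \<Rightarrow>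
    (int \<Rightarrow> 'a \<Rightarrow> 'a) \<Rightarrow> int \<Rightarrow> real" where
  "eta W V d \<pi> k =
    Max (\<Union>j\<in>{0, 1}. {d_solution_error W V d \<pi> (k - j), adj_solution_error W V d \<pi> (k + j)})"

end

theory Submission
  imports Defs
begin

text \<open>
  Every part of the error is written as a vector \<open>x\<close> for which \<open>\<langle>x, x\<rangle>\<close> can be rewritten, by
  the equations and by Galerkin orthogonality, as a sum of inner products in which \<open>x\<close> enters only
  through some \<open>(I - \<pi>) T x\<close> with \<open>T\<close> one of \<open>K\<close>, \<open>d K\<close>, \<open>d\<^sup>* K\<close>, \<open>P\<^bsub>H\<^esub>\<close>; this is where
  \<open>\<delta>\<close>, \<open>\<eta>\<close>, \<open>\<mu>\<close> come from.  A discrete field \<open>v\<^sub>h\<close> orthogonal to the discrete cocycles is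
  compared with its component \<open>v\<close> orthogonal to all cocycles: as \<open>d v = d v\<^sub>h\<close>, the vector
  \<open>v\<^sub>h - \<pi> v\<close> is a discrete cocycle, so \<open>\<parallel>v\<^sub>h - v\<parallel> \<le> \<parallel>v - \<pi> v\<parallel> \<le> \<eta> \<parallel>d v\<^sub>h\<parallel>\<close>, because
  \<open>v = d\<^sup>* K d v\<^sub>h\<close>.  For the last estimate, \<open>\<pi> u - u\<^sub>h\<close> is split by the discrete Hodge
  decomposition.
\<close>

section \<open>Orthogonal projections in inner product spaces\<close>

text \<open>The obstacle is that only part of the Hodge decomposition is inherited by a subcomplex:
  discrete cocycles and coboundaries are cocycles and coboundaries, but discrete harmonic and
  discrete coexact fields need not be harmonic or coexact. Each failure has its own defect estimate,
  \<open>discrete_harmonic_error\<close> with factor \<mu> and \<open>discrete_coexact_error\<close>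
  with factor \<eta>. Products of small factors arise where defects meet:
  \<open>\<eta>\<^sup>2\<close> where a bound with factor \<eta> is applied to an error of
  \<open>d u\<close> or \<sigma> that already carries \<eta>, and the term with \<mu> for
  \<open>u\<close> where a harmonic defect is paired with the projection error of the exact part of
  \<open>u\<close>. The numbers \<delta>, \<mu>, \<eta> are suprema and say something only about
  bounded operators. Boundedness of the solution operator rests on the Poincare inequality, and that
  is where compactness is spent. The ambient space need not be complete, so Riesz representation and
  projections are set up for complete subspaces and, separately, for finite-dimensional
  ones.\<close>

lemma mem_orthogonal_comp: "x \<in> S\<^sup>\<bottom> \<longleftrightarrow> (\<forall>y\<in>S. inner x y = 0)"
  by (auto simp: orthogonal_comp_def orthogonal_def inner_commute)

lemma orthogonal_compD: "x \<in> S\<^sup>\<bottom> \<Longrightarrow> y \<in> S \<Longrightarrow> inner x y = 0"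
  "x \<in> S\<^sup>\<bottom> \<Longrightarrow> y \<in> S \<Longrightarrow> inner y x = 0"
  by (auto simp: mem_orthogonal_comp inner_commute)

lemma closed_orthogonal_comp: "closed (S\<^sup>\<bottom>)" for S :: "'a::real_inner set"
proof -
  have "S\<^sup>\<bottom> = (\<Inter>y\<in>S. {x. inner x y = 0})" by (auto simp: mem_orthogonal_comp)
  moreover have "closed {x. inner x y = 0}" for y :: 'a
    by (intro closed_Collect_eq continuous_intros)
  ultimately show ?thesis by auto
qed

text \<open>Closes every duality argument below: one factor \<open>norm x\<close> is cancelled, and
  \<open>0 \<le> c\<close> covers \<open>x = 0\<close>.\<close>

lemma norm_le_if_inner_le:
  fixes x :: "'a::real_inner"
  assumes "inner x x \<le> c * norm x" and "0 \<le> c"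
  shows "norm x \<le> c"
proof (cases "x = 0")
  case False
  have "norm x * norm x \<le> c * norm x"
    using assms(1) by (simp add: power2_norm_eq_inner flip: power2_eq_square)
  then show ?thesis using False by simp
qed (use assms in simp)

text \<open>Best approximation in disguise: \<open>x\<close> will be an error and
  \<open>x + y\<close> the error of a competitor, usually one given by \<pi>.\<close>

lemma norm_le_norm_add_if_orthogonal:
  fixes x y :: "'a::real_inner"
  assumes "inner x y = 0"
  shows "norm x \<le> norm (x + y)"
proof (rule power2_le_imp_le)
  have "(norm (x + y))\<^sup>2 = (norm x)\<^sup>2 + (norm y)\<^sup>2"
    using assms by (intro norm_add_Pythagorean) (simp add: orthogonal_def)
  then show "(norm x)\<^sup>2 \<le> (norm (x + y))\<^sup>2" by simp
qed simp

lemma lin_on_diff: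
  assumes "lin_on S f" "subspace S" "x \<in> S" "y \<in> S"
  shows "f (x - y) = f x - f y"
proof -
  have "(-1) *\<^sub>R y \<in> S" using assms by (intro subspace_mul)
  then have "f (x + (-1) *\<^sub>R y) = f x + (-1) *\<^sub>R f y"
    using assms unfolding lin_on_def by metis
  then show ?thesis by simp
qed

lemma lin_on_0:
  assumes "lin_on S f" "subspace S"
  shows "f 0 = 0"
  using lin_on_diff[OF assms, of 0 0] subspace_0[OF assms(2)] by simp

text \<open>The representing vector minimizes \<open>y \<mapsto> \<parallel>y\<parallel>\<^sup>2 - 2 \<phi> y\<close>; a minimizing sequence is Cauchy
  by the parallelogram law.\<close>
lemma riesz_representation:
  fixes S :: "'a::real_inner set" and \<phi> :: "'a \<Rightarrow> real"
  assumes S: "subspace S" "complete S" and lin: "lin_on S \<phi>"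
    and bound: "\<And>x. x \<in> S \<Longrightarrow> \<bar>\<phi> x\<bar> \<le> c * norm x"
  obtains r where "r \<in> S" "\<And>x. x \<in> S \<Longrightarrow> inner r x = \<phi> x"
proof -
  define J where "J y = inner y y - 2 * \<phi> y" for y
  define m where "m = (INF y\<in>S. J y)"
  have add: "\<phi> (x + y) = \<phi> x + \<phi> y" if "x \<in> S" "y \<in> S" for x y
    using lin that by (auto simp: lin_on_def)
  have scale: "\<phi> (a *\<^sub>R x) = a * \<phi> x" if "x \<in> S" for x a
    using lin that by (auto simp: lin_on_def)
  have ne: "S \<noteq> {}" using S(1) subspace_0 by blast
  have lower: "- c\<^sup>2 \<le> J y" if "y \<in> S" for y
  proof -
    have "0 \<le> (norm y - c)\<^sup>2" by simp
    then have "0 \<le> inner y y - 2 * (c * norm y) + c\<^sup>2"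
      by (simp add: power2_diff power2_norm_eq_inner mult_ac)
    then show ?thesis using bound[OF that] unfolding J_def by linarith
  qed
  have bdd: "bdd_below (J ` S)" using lower by (auto intro!: bdd_belowI)
  have m_le: "m \<le> J y" if "y \<in> S" for y
    unfolding m_def by (rule cINF_lower[OF bdd that])
  have "\<exists>y\<in>S. J y < m + inverse (real (Suc n))" for n
  proof -
    have "\<exists>x\<in>J ` S. x < m + inverse (real (Suc n))"
      by (rule cInf_lessD) (use ne in \<open>auto simp: m_def\<close>)
    then show ?thesis by blast
  qed
  then obtain y where yS: "\<And>n. y n \<in> S" and yJ: "\<And>n. J (y n) < m + inverse (real (Suc n))"
    by metis
  have par: "inner (a - b) (a - b) \<le> 2 * (J a - m) + 2 * (J b - m)" if "a \<in> S" "b \<in> S" for a b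
  proof -
    have mid: "(1/2) *\<^sub>R (a + b) \<in> S" using that S by (intro subspace_mul subspace_add)
    have "\<phi> ((1/2) *\<^sub>R (a + b)) = (\<phi> a + \<phi> b) / 2"
      using that S by (simp add: scale add subspace_add)
    then have "4 * J ((1/2) *\<^sub>R (a + b)) = inner (a + b) (a + b) - 4 * (\<phi> a + \<phi> b)"
      by (simp add: J_def)
    moreover have "inner (a - b) (a - b) = 2 * inner a a + 2 * inner b b - inner (a + b) (a + b)"
      by (simp add: inner_simps inner_commute)
    ultimately show ?thesis
      using m_le[OF mid] J_def[of a] J_def[of b] by argo
  qed
  have "Cauchy y"
  proof (rule metric_CauchyI)
    fix e :: real assume "0 < e"
    then obtain N where N: "N \<noteq> 0" "inverse (real N) < e\<^sup>2 / 4"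
      using real_arch_inverse[of "e\<^sup>2 / 4"] by auto
    show "\<exists>N. \<forall>i\<ge>N. \<forall>j\<ge>N. dist (y i) (y j) < e"
    proof (intro exI allI impI)
      fix i j assume ij: "N \<le> i" "N \<le> j"
      have "inverse (real (Suc n)) \<le> inverse (real N)" if "N \<le> n" for n
        using that N(1) by (intro le_imp_inverse_le) auto
      then have J_close: "J (y n) - m < e\<^sup>2 / 4" if "N \<le> n" for n
        using yJ[of n] N(2) that by fastforce
      have "inner (y i - y j) (y i - y j) < e\<^sup>2"
        using par[OF yS yS, of i j] J_close[OF ij(1)] J_close[OF ij(2)] by argo
      then show "dist (y i) (y j) < e"
        using \<open>0 < e\<close> by (simp add: dist_norm power2_norm_eq_inner[symmetric] power2_less_imp_less)
    qed
  qed
  then obtain r where r: "r \<in> S" "y \<longlonglongrightarrow> r"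
    using S(2) yS unfolding complete_def by blast
  have "(\<lambda>n. \<phi> (y n)) \<longlonglongrightarrow> \<phi> r"
  proof (rule Lim_null_comparison[where g = "\<lambda>n. c * norm (y n - r)" and f = "\<lambda>n. \<phi> (y n) - \<phi> r",
        THEN LIM_zero_cancel])
    show "\<forall>\<^sub>F n in sequentially. norm (\<phi> (y n) - \<phi> r) \<le> c * norm (y n - r)"
      using bound[OF subspace_diff[OF S(1) yS r(1)]] lin_on_diff[OF lin S(1) yS r(1)] by auto
    show "(\<lambda>n. c * norm (y n - r)) \<longlonglongrightarrow> 0"
      using r(2) by (intro tendsto_mult_right_zero tendsto_norm_zero LIM_zero)
  qed
  then have "(\<lambda>n. J (y n)) \<longlonglongrightarrow> J r"
    unfolding J_def using r(2) by (intro tendsto_intros)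
  moreover have "(\<lambda>n. m + inverse (real (Suc n))) \<longlonglongrightarrow> m + 0"
    by (intro tendsto_intros LIMSEQ_inverse_real_of_nat)
  ultimately have "J r \<le> m + 0"
    using yJ by (intro LIMSEQ_le[of "\<lambda>n. J (y n)" "J r"]) (auto intro: less_imp_le)
  then have min: "J r \<le> J y" if "y \<in> S" for y using m_le[OF that] by simp
  have "inner r x = \<phi> x" if x: "x \<in> S" for x
  proof (cases "x = 0")
    case True
    then show ?thesis using lin_on_0[OF lin S(1)] by simp
  next
    case False
    \<comment> \<open>The minimizer of the quadratic \<open>J (r + t *\<^sub>R x)\<close> in
      \<open>t\<close>.\<close>
    define t where "t = (\<phi> x - inner r x) / inner x x"
    have "J (r + t *\<^sub>R x) = J r + t * (t * inner x x) - 2 * t * (\<phi> x - inner r x)"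
      using r(1) x S by (simp add: J_def add scale subspace_mul inner_simps inner_commute algebra_simps)
    also have "t * inner x x = \<phi> x - inner r x" using False by (simp add: t_def)
    finally have "t * (\<phi> x - inner r x) \<le> 0"
      using min[of "r + t *\<^sub>R x"] r(1) x S by (simp add: subspace_add subspace_mul)
    then have "(\<phi> x - inner r x)\<^sup>2 / inner x x \<le> 0" by (simp add: t_def power2_eq_square)
    moreover have "0 < inner x x" using False by simp
    ultimately show ?thesis by (simp add: divide_le_0_iff)
  qed
  with r(1) show ?thesis by (rule that)
qed

lemma orth_proj_eqI:
  assumes "subspace S" "y \<in> S" "x - y \<in> S\<^sup>\<bottom>"
  shows "orth_proj S x = y"
  unfolding orth_proj_def
proof (rule the_equality)
  fix z assume z: "z \<in> S \<and> x - z \<in> S\<^sup>\<bottom>"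
  then have "z - y \<in> S" using assms by (simp add: subspace_diff)
  then have "inner (z - y) (x - y) = 0" "inner (z - y) (x - z) = 0"
    using z assms(3) by (auto intro: orthogonal_compD)
  then have "inner (z - y) (z - y) = 0" by (simp add: inner_diff_right)
  then show "z = y" by simp
qed (use assms in auto)

lemma orth_proj_complete:
  assumes "subspace S" "complete S"
  shows orth_proj_in: "orth_proj S x \<in> S" and orth_proj_perp: "x - orth_proj S x \<in> S\<^sup>\<bottom>"
proof -
  obtain y where y: "y \<in> S" "\<And>z. z \<in> S \<Longrightarrow> inner y z = inner x z"
  proof (rule riesz_representation[OF assms, of "inner x" "norm x"])
    show "lin_on S (inner x)" by (simp add: lin_on_def inner_simps)
    show "\<bar>inner x z\<bar> \<le> norm x * norm z" for z by (rule Cauchy_Schwarz_ineq2)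
  qed blast
  then have "x - y \<in> S\<^sup>\<bottom>" by (simp add: mem_orthogonal_comp inner_simps)
  with y(1) have "orth_proj S x = y" by (intro orth_proj_eqI assms)
  with y(1) \<open>x - y \<in> S\<^sup>\<bottom>\<close> show "orth_proj S x \<in> S" "x - orth_proj S x \<in> S\<^sup>\<bottom>" by auto
qed

lemma norm_orth_proj_le:
  assumes "subspace S" "complete S"
  shows "norm (orth_proj S x) \<le> norm x" "norm (x - orth_proj S x) \<le> norm x"
proof -
  note P = orth_proj_complete[OF assms, of x]
  show "norm (orth_proj S x) \<le> norm x"
    using norm_le_norm_add_if_orthogonal[of "orth_proj S x" "x - orth_proj S x"]
    by (simp add: orthogonal_compD(2)[OF P(2,1)])
  show "norm (x - orth_proj S x) \<le> norm x"
    using norm_le_norm_add_if_orthogonal[of "x - orth_proj S x" "orth_proj S x"]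
    by (simp add: orthogonal_compD(1)[OF P(2,1)])
qed

text \<open>One Gram-Schmidt step per generator, \<open>g\<close> being the part of \<open>b\<close>
  orthogonal to \<open>span B\<close>. This serves the discrete spaces without an appeal to
  completeness.\<close>

lemma orth_proj_exists_span:
  fixes x :: "'a::real_inner"
  assumes "finite B"
  shows "\<exists>y\<in>span B. x - y \<in> (span B)\<^sup>\<bottom>"
  using assms
proof (induction B arbitrary: x rule: finite_induct)
  case empty
  show ?case by (simp add: mem_orthogonal_comp)
next
  case (insert b B)
  obtain y where y: "y \<in> span B" "x - y \<in> (span B)\<^sup>\<bottom>" using insert.IH by blast
  obtain b0 where b0: "b0 \<in> span B" "b - b0 \<in> (span B)\<^sup>\<bottom>" using insert.IH by blast
  define g where "g = b - b0"
  \<comment> \<open>If \<open>b\<close> already lies in \<open>span B\<close>, then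
    \<open>g = 0\<close> and division by zero gives \<open>t = 0\<close>; the value is harmless
    because \<open>g\<close> contributes nothing.\<close>
  define t where "t = inner x g / inner g g"
  have sub: "z \<in> span (insert b B)" if "z \<in> span B" for z
    using that span_mono[of B "insert b B"] by auto
  have g_in: "g \<in> span (insert b B)"
    unfolding g_def by (rule span_diff[OF span_base sub[OF b0(1)]]) simp
  have tg: "inner (x - (y + t *\<^sub>R g)) g = 0"
  proof (cases "g = 0")
    case False
    then show ?thesis using orthogonal_compD(2)[OF b0(2) y(1)]
      by (simp add: inner_simps t_def flip: g_def)
  qed simp
  have "inner (x - (y + t *\<^sub>R g)) z = 0" if "z \<in> span (insert b B)" for z
  proof -
    obtain a where a: "z - a *\<^sub>R b \<in> span B" using \<open>z \<in> _\<close> by (auto simp: span_insert)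
    then have w: "z - a *\<^sub>R g \<in> span B"
      using span_add[OF a span_scale[OF b0(1), of a]] by (simp add: g_def algebra_simps)
    have "inner (x - (y + t *\<^sub>R g)) (z - a *\<^sub>R g) = 0"
      using orthogonal_compD(1)[OF y(2) w] orthogonal_compD(1)[OF b0(2) w]
      by (simp add: inner_diff_left inner_add_left flip: g_def)
    then show ?thesis using tg by (simp add: inner_diff_right)
  qed
  moreover have "y + t *\<^sub>R g \<in> span (insert b B)"
    by (rule span_add[OF sub[OF y(1)] span_scale[OF g_in]])
  ultimately show ?case by (auto simp: mem_orthogonal_comp)
qed

lemma orth_proj_finite_dim:
  fixes S :: "'a::real_inner set"
  assumes "subspace S" "S \<subseteq> span B" "finite B"
  shows "orth_proj S x \<in> S" "x - orth_proj S x \<in> S\<^sup>\<bottom>"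
proof -
  obtain C where C: "C \<subseteq> S" "independent C" "S \<subseteq> span C"
    using maximal_independent_subset[of S] by blast
  then have "finite C" using assms independent_span_bound[of B C] by blast
  moreover have "span C = S" using C assms(1) by (simp add: span_subspace)
  ultimately obtain y where y: "y \<in> S" "x - y \<in> S\<^sup>\<bottom>" using orth_proj_exists_span[of C x] by auto
  then have "orth_proj S x = y" by (intro orth_proj_eqI assms)
  with y show "orth_proj S x \<in> S" "x - orth_proj S x \<in> S\<^sup>\<bottom>" by auto
qed

text \<open>The supremum in \<open>onorm_on\<close> can be used only once the quotients are known to
  be bounded, hence the auxiliary constant \<open>c\<close>. The vector 0 contributes the quotient
  0.\<close>

lemma onorm_on_bounded:
  assumes "\<And>x. x \<in> S \<Longrightarrow> norm (T x) \<le> c * norm x" and "0 \<le> c"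
  shows le_onorm_on: "x \<in> S \<Longrightarrow> norm (T x) \<le> onorm_on S T * norm x"
    and onorm_on_le: "S \<noteq> {} \<Longrightarrow> onorm_on S T \<le> c"
    and onorm_on_nonneg: "S \<noteq> {} \<Longrightarrow> 0 \<le> onorm_on S T"
proof -
  have le: "norm (T x) / norm x \<le> c" if "x \<in> S" for x
    using assms(1)[OF that] assms(2) by (cases "x = 0") (auto simp: divide_le_eq)
  then have bdd: "bdd_above ((\<lambda>x. norm (T x) / norm x) ` S)" by (auto intro!: bdd_aboveI)
  have up: "norm (T x) / norm x \<le> onorm_on S T" if "x \<in> S" for x
    unfolding onorm_on_def by (rule cSUP_upper[OF that bdd])
  show "norm (T x) \<le> onorm_on S T * norm x" if "x \<in> S"
    using up[OF that] assms(1)[OF that] by (cases "x = 0") (auto simp: divide_le_eq)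
  show "onorm_on S T \<le> c" if "S \<noteq> {}"
    unfolding onorm_on_def by (rule cSUP_least[OF that le])
  show "0 \<le> onorm_on S T" if "S \<noteq> {}"
    using that up by (meson all_not_in_conv divide_nonneg_nonneg norm_ge_zero order_trans)
qed

section \<open>The solution operator of a Hilbert complex\<close>

context hilbert_complex
begin

section \<open>Linear structure and closedness of the cochain subspaces\<close>

lemma d_add: "v \<in> V j \<Longrightarrow> w \<in> V j \<Longrightarrow> d j (v + w) = d j v + d j w"
  and d_scale: "v \<in> V j \<Longrightarrow> d j (c *\<^sub>R v) = c *\<^sub>R d j v"
  using d_linear[of j] by (auto simp: lin_on_def)

lemma d_diff: "v \<in> V j \<Longrightarrow> w \<in> V j \<Longrightarrow> d j (v - w) = d j v - d j w"
  by (rule lin_on_diff[OF d_linear subspace_V])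

lemma d_0: "d j 0 = 0"
  by (rule lin_on_0[OF d_linear subspace_V])

lemma V_in_W: "v \<in> V j \<Longrightarrow> v \<in> W j"
  using V_subset by blast

lemma subspace_cocycles: "subspace (cocycles V d j)"
  using subspace_V[of j] by (auto simp: subspace_def cocycles_def d_add d_scale d_0)

lemma cocyclesD: "v \<in> cocycles V d j \<Longrightarrow> v \<in> V j" "v \<in> cocycles V d j \<Longrightarrow> d j v = 0"
  by (auto simp: cocycles_def)

lemma coboundariesI: "v \<in> V (j - 1) \<Longrightarrow> d (j - 1) v \<in> coboundaries V d j"
  by (auto simp: coboundaries_def)

lemma coboundaries_subset_cocycles: "coboundaries V d j \<subseteq> cocycles V d j"
  using d_range[of _ "j - 1"] d_d[of _ "j - 1"] by (auto simp: coboundaries_def cocycles_def)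

lemma subspace_coboundaries: "subspace (coboundaries V d j)"
proof (rule subspaceI)
  note S = subspace_V[of "j - 1"]
  show "0 \<in> coboundaries V d j"
    using coboundariesI[OF subspace_0[OF S]] by (simp add: d_0)
  fix x assume "x \<in> coboundaries V d j"
  then obtain v where v: "v \<in> V (j - 1)" "x = d (j - 1) v" by (auto simp: coboundaries_def)
  show "c *\<^sub>R x \<in> coboundaries V d j" for c
    using coboundariesI[OF subspace_mul[OF S v(1)]] v by (simp add: d_scale)
  fix y assume "y \<in> coboundaries V d j"
  then obtain w where w: "w \<in> V (j - 1)" "y = d (j - 1) w" by (auto simp: coboundaries_def)
  show "x + y \<in> coboundaries V d j"
    using coboundariesI[OF subspace_add[OF S v(1) w(1)]] v w by (simp add: d_add)
qed

lemma limit_in_domain: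
  assumes "\<And>n. x n \<in> V j" "x \<longlonglongrightarrow> l" "(\<lambda>n. d j (x n)) \<longlonglongrightarrow> m"
  shows "l \<in> V j" "d j l = m"
proof -
  have "(\<lambda>n. (x n, d j (x n))) \<longlonglongrightarrow> (l, m)" by (intro tendsto_Pair assms)
  then have "(l, m) \<in> (\<lambda>v. (v, d j v)) ` V j"
    by (rule closed_sequentially[OF d_closed, rotated]) (use assms(1) in simp)
  then show "l \<in> V j" "d j l = m" by auto
qed

text \<open>The domain \<open>V j\<close> need not be complete. A limit exists in
  \<open>W j\<close>, and closedness of the graph places it in the kernel.\<close>

lemma complete_cocycles: "complete (cocycles V d j)"
proof (rule completeI)
  fix x assume x: "\<forall>n. x n \<in> cocycles V d j" "Cauchy x"
  then have xV: "x n \<in> V j" "d j (x n) = 0" for n by (auto simp: cocycles_def)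
  then obtain l where l: "x \<longlonglongrightarrow> l"
    using completeE[OF complete_W _ x(2), of j] V_in_W by metis
  moreover have "l \<in> cocycles V d j"
    using limit_in_domain[OF xV(1) l, of 0] xV(2) by (simp add: cocycles_def)
  ultimately show "\<exists>l\<in>cocycles V d j. x \<longlonglongrightarrow> l" by blast
qed

lemma subspace_harmonics: "subspace (harmonics V d j)"
  unfolding harmonics_def by (intro subspace_inter subspace_cocycles subspace_orthogonal_comp)

lemma complete_harmonics: "complete (harmonics V d j)"
  unfolding harmonics_def by (intro complete_Int_closed complete_cocycles closed_orthogonal_comp)

lemma harmonicsD: "p \<in> harmonics V d j \<Longrightarrow> p \<in> cocycles V d j"
  "p \<in> harmonics V d j \<Longrightarrow> p \<in> (coboundaries V d j)\<^sup>\<bottom>"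
  by (auto simp: harmonics_def)

text \<open>The normal form of a potential: only a cocycle is removed, so \<open>d j v\<close> is
  kept while the norm does not grow.\<close>

definition coexact_part :: "int \<Rightarrow> 'a \<Rightarrow> 'a" where
  "coexact_part j v = v - orth_proj (cocycles V d j) v"

lemma coexact_part_perp: "coexact_part j v \<in> (cocycles V d j)\<^sup>\<bottom>"
  unfolding coexact_part_def by (rule orth_proj_perp[OF subspace_cocycles complete_cocycles])

lemma coexact_part_diff_cocycle: "v - coexact_part j v \<in> cocycles V d j"
  unfolding coexact_part_def
  using orth_proj_in[OF subspace_cocycles complete_cocycles] by simp

lemma norm_coexact_part_le: "norm (coexact_part j v) \<le> norm v"
  unfolding coexact_part_def by (rule norm_orth_proj_le[OF subspace_cocycles complete_cocycles])

lemma coexact_part_in: "v \<in> V j \<Longrightarrow> coexact_part j v \<in> V j"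
  using coexact_part_diff_cocycle[of v j] subspace_diff[OF subspace_V, of v j "v - coexact_part j v"]
  by (simp add: cocyclesD)

lemma d_coexact_part:
  assumes "v \<in> V j"
  shows "d j (coexact_part j v) = d j v"
  using cocyclesD(2)[OF coexact_part_diff_cocycle[of v j]] assms
  by (simp add: d_diff coexact_part_in)

text \<open>Used to recognise a coexact part: it suffices to exhibit another coexact field with the
  same derivative.\<close>

lemma perp_cocycles_unique:
  assumes "v \<in> V j" "w \<in> V j" "v \<in> (cocycles V d j)\<^sup>\<bottom>" "w \<in> (cocycles V d j)\<^sup>\<bottom>" "d j v = d j w"
  shows "v = w"
proof -
  have "v - w \<in> cocycles V d j"
    using assms by (simp add: cocycles_def d_diff subspace_diff[OF subspace_V])
  moreover have "v - w \<in> (cocycles V d j)\<^sup>\<bottom>"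
    using assms by (simp add: subspace_diff[OF subspace_orthogonal_comp])
  ultimately have "inner (v - w) (v - w) = 0" by (rule orthogonal_compD(1)[rotated])
  then show ?thesis by simp
qed

text \<open>Density of \<open>V (j - 1)\<close> makes the adjoint single-valued: the difference of
  two candidates is orthogonal to a set whose closure contains it.\<close>

lemma adj_eqI:
  assumes "w \<in> W (j - 1)" "\<And>v. v \<in> V (j - 1) \<Longrightarrow> inner (d (j - 1) v) u = inner v w"
  shows "adj W V d j u = w"
  unfolding adj_def
proof (rule the_equality)
  fix z assume z: "z \<in> W (j - 1) \<and> (\<forall>v\<in>V (j - 1). inner (d (j - 1) v) u = inner v z)"
  have "V (j - 1) \<subseteq> {v. inner v (z - w) = 0}"
    using z assms(2) by (auto simp: inner_simps)
  then have "closure (V (j - 1)) \<subseteq> {v. inner v (z - w) = 0}"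
    by (rule closure_minimal) (intro closed_Collect_eq continuous_intros)
  moreover have "z - w \<in> closure (V (j - 1))"
    using V_dense subspace_diff[OF subspace_W] z assms(1) by blast
  ultimately have "inner (z - w) (z - w) = 0" by blast
  then show "z = w" by simp
qed (use assms in auto)

text \<open>Test with \<open>v = d \<sigma>\<close>, \<open>v = p\<close> and \<open>v = u\<close>, then \<open>\<tau> = \<sigma>\<close>; what remains of \<open>u\<close> is harmonic.\<close>
lemma mixed_solution_0:
  assumes "mixed_solution V d j 0 \<sigma> u p"
  shows "\<sigma> = 0" "u = 0" "p = 0"
proof -
  note eqs = assms[unfolded mixed_solution_def]
  have sV: "\<sigma> \<in> V (j - 1)" and uV: "u \<in> V j" and pH: "p \<in> harmonics V d j" using eqs by auto
  have e2: "inner (d (j - 1) \<sigma>) v + inner (d j u) (d j v) + inner v p = 0" if "v \<in> V j" for v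
    using eqs that by auto
  have dsZ: "d (j - 1) \<sigma> \<in> cocycles V d j"
    using coboundariesI[OF sV] coboundaries_subset_cocycles by blast
  have dsp: "inner (d (j - 1) \<sigma>) p = 0"
    using orthogonal_compD(2)[OF harmonicsD(2)[OF pH] coboundariesI[OF sV]] .
  have ds: "d (j - 1) \<sigma> = 0" using e2[of "d (j - 1) \<sigma>"] dsZ dsp by (simp add: cocyclesD)
  show p: "p = 0" using e2[of p] ds harmonicsD(1)[OF pH] by (simp add: cocyclesD)
  have du: "d j u = 0" using e2[OF uV] ds p by simp
  have "inner \<sigma> \<sigma> - inner (d (j - 1) \<sigma>) u = 0" using eqs sV by blast
  then show s: "\<sigma> = 0" using ds by simp
  have "u \<in> harmonics V d j"
    using eqs s uV du by (auto simp: harmonics_def cocycles_def coboundaries_def mem_orthogonal_comp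
        inner_commute)
  then have "inner u u = 0" using eqs by blast
  then show "u = 0" by simp
qed

lemma mixed_solution_unique:
  assumes "mixed_solution V d j f \<sigma> u p" "mixed_solution V d j f \<sigma>' u' p'"
  shows "\<sigma> = \<sigma>'" "u = u'" "p = p'"
proof -
  have "mixed_solution V d j 0 (\<sigma> - \<sigma>') (u - u') (p - p')"
    using assms unfolding mixed_solution_def
    by (auto simp: d_diff inner_diff_left inner_diff_right subspace_diff[OF subspace_V]
        subspace_diff[OF subspace_harmonics] algebra_simps)
  from mixed_solution_0[OF this] show "\<sigma> = \<sigma>'" "u = u'" "p = p'" by auto
qed

end

locale compact_hilbert_complex = closed_hilbert_complex W V d
  for W V :: "int \<Rightarrow> 'a::real_inner set" and d :: "int \<Rightarrow> 'a \<Rightarrow> 'a" +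
  assumes compactness: "compactness_property W V d"
begin

section \<open>Poincare inequality and well-posedness of the mixed problem\<close>

lemma complete_coboundaries: "complete (coboundaries V d j)"
proof -
  have "coboundaries V d j \<subseteq> W j"
    using d_in_W[of _ "j - 1"] by (auto simp: coboundaries_def)
  then have "W j \<inter> coboundaries V d j = coboundaries V d j" by blast
  then show ?thesis
    using complete_Int_closed[OF complete_W closed_range[of "j - 1"], of j]
    by (simp add: coboundaries_def)
qed

text \<open>Coboundaries are cocycles, so coexact fields lie in the kernel of the adjoint. In the
  compactness norm they are therefore controlled by \<open>v\<close> and \<open>d j v\<close>
  alone.\<close>

lemma perp_cocycles_adj:
  assumes "v \<in> W j" "v \<in> (cocycles V d j)\<^sup>\<bottom>"
  shows "v \<in> adj_dom W V d j" "adj W V d j v = 0"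
proof -
  have *: "inner (d (j - 1) w) v = inner w 0" if "w \<in> V (j - 1)" for w
    using orthogonal_compD(2)[OF assms(2)] coboundariesI[OF that] coboundaries_subset_cocycles
    by auto
  show "v \<in> adj_dom W V d j"
    unfolding adj_dom_def using assms(1) * subspace_0[OF subspace_W] by blast
  show "adj W V d j v = 0" by (rule adj_eqI) (use * subspace_0[OF subspace_W] in auto)
qed

text \<open>A sequence violating the inequality lies in the domain of the adjoint, which annihilates it;
  by compactness it has a limit point, which is both a cocycle and orthogonal to the cocycles.\<close>
lemma poincare:
  obtains c where "0 \<le> c"
    "\<And>v. v \<in> V j \<Longrightarrow> v \<in> (cocycles V d j)\<^sup>\<bottom> \<Longrightarrow> norm v \<le> c * norm (d j v)"
proof (rule ccontr)
  assume "\<not> thesis"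
  then have "\<exists>v. v \<in> V j \<and> v \<in> (cocycles V d j)\<^sup>\<bottom> \<and> real (Suc n) * norm (d j v) < norm v" for n
    using that[OF of_nat_0_le_iff, of "Suc n"] by (meson linorder_not_le)
  then obtain v where v: "\<And>n. v n \<in> V j" "\<And>n. v n \<in> (cocycles V d j)\<^sup>\<bottom>"
    "\<And>n. real (Suc n) * norm (d j (v n)) < norm (v n)" by metis
  \<comment> \<open>Norm 1/2 rather than 1: the ball of the compactness property counts
    \<open>(norm v)\<^sup>2\<close> twice, which gives 1/2, and the derivative adds at most
    1/4.\<close>
  define x where "x n = (1 / (2 * norm (v n))) *\<^sub>R v n" for n
  have vpos: "0 < norm (v n)" for n
    using v(3)[of n] by (meson mult_nonneg_nonneg norm_ge_zero of_nat_0_le_iff order_le_less_trans)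
  have xV: "x n \<in> V j" and xperp: "x n \<in> (cocycles V d j)\<^sup>\<bottom>" for n
    using v unfolding x_def by (auto intro: subspace_mul subspace_V subspace_orthogonal_comp)
  have xnorm: "norm (x n) = 1 / 2" for n using vpos[of n] by (simp add: x_def)
  have dx: "norm (d j (x n)) \<le> inverse (real (Suc n)) / 2" for n
    using v(3)[of n] v(1)[of n] vpos[of n] by (simp add: x_def d_scale field_simps)
  define S where "S = {v \<in> V j \<inter> adj_dom W V d j.
      ((norm v)\<^sup>2 + (norm (d j v))\<^sup>2) + (norm v)\<^sup>2 + (norm (adj W V d j v))\<^sup>2 \<le> 1}"
  have xS: "x n \<in> S" for n
  proof -
    have "norm (d j (x n)) \<le> 1 / 2"
      using dx[of n] by (rule order_trans) (simp add: divide_simps)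
    then have "(norm (d j (x n)))\<^sup>2 \<le> (1 / 2)\<^sup>2" by (rule power_mono) simp
    then show ?thesis
      using perp_cocycles_adj[OF V_in_W[OF xV] xperp] xV[of n]
      by (simp add: S_def xnorm power2_eq_square)
  qed
  have "compact (closure S)"
    using compactness by (simp add: compactness_property_def S_def)
  then have "seq_compact (closure S)" by (rule compact_imp_seq_compact)
  moreover have "\<forall>n. x n \<in> closure S" using xS closure_subset by blast
  ultimately obtain l r where r: "strict_mono r" "(x \<circ> r) \<longlonglongrightarrow> l"
    by (rule seq_compactE)
  have "(\<lambda>n. d j (x n)) \<longlonglongrightarrow> 0"
  proof (rule Lim_null_comparison)
    show "(\<lambda>n. inverse (real (Suc n)) / 2) \<longlonglongrightarrow> 0"
      using LIMSEQ_inverse_real_of_nat by (rule tendsto_divide_zero)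
  qed (use dx in simp)
  then have dr: "(\<lambda>n. d j ((x \<circ> r) n)) \<longlonglongrightarrow> 0"
    using r(1) by (auto dest: LIMSEQ_subseq_LIMSEQ simp: o_def)
  have "l \<in> cocycles V d j"
    using limit_in_domain[OF _ r(2) dr] xV by (simp add: cocycles_def)
  moreover have "l \<in> (cocycles V d j)\<^sup>\<bottom>"
    by (rule closed_sequentially[OF closed_orthogonal_comp _ r(2)]) (use xperp in simp)
  ultimately have "inner l l = 0" by (rule orthogonal_compD(1)[rotated])
  moreover have "norm l = 1 / 2"
    using LIMSEQ_unique[OF tendsto_norm[OF r(2)], of "1 / 2"] by (simp add: o_def xnorm)
  ultimately show False by simp
qed

text \<open>Weak solution of \<open>d* r = g\<close> with \<open>r\<close> exact. In terms of the
  inverse of \<open>d j\<close> on coexact fields, \<open>r\<close> is its adjoint applied to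
  \<open>g\<close>; the Poincare constant bounds the functional that Riesz represents on the
  coboundaries.\<close>

lemma exact_lift:
  obtains c where "0 \<le> c" "\<And>g. g \<in> (cocycles V d j)\<^sup>\<bottom> \<Longrightarrow>
    \<exists>r\<in>coboundaries V d (j + 1). norm r \<le> c * norm g \<and> (\<forall>v\<in>V j. inner r (d j v) = inner g v)"
proof -
  obtain c where c: "0 \<le> c"
    "\<And>v. v \<in> V j \<Longrightarrow> v \<in> (cocycles V d j)\<^sup>\<bottom> \<Longrightarrow> norm v \<le> c * norm (d j v)"
    by (rule poincare[of j]) blast
  define pot where "pot b = coexact_part j (inv_into (V j) (d j) b)" for b
  have cob: "coboundaries V d (j + 1) = d j ` V j" by (simp add: coboundaries_def)
  have pot: "pot b \<in> V j" "pot b \<in> (cocycles V d j)\<^sup>\<bottom>" "d j (pot b) = b"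
    if "b \<in> d j ` V j" for b
    using inv_into_into[OF that] f_inv_into_f[OF that]
    by (simp_all add: pot_def coexact_part_in coexact_part_perp d_coexact_part)
  have "\<exists>r\<in>coboundaries V d (j + 1). norm r \<le> c * norm g \<and> (\<forall>v\<in>V j. inner r (d j v) = inner g v)"
    if g: "g \<in> (cocycles V d j)\<^sup>\<bottom>" for g
  proof -
    \<comment> \<open>A coexact \<open>g\<close> sees \<open>v\<close> only modulo cocycles.
      Linearity of the functional follows from this, although \<open>pot\<close> starts from an
      arbitrary choice of preimages.\<close>
    have gpot: "inner g (pot (d j v)) = inner g v" if "v \<in> V j" for v
    proof -
      have "v - pot (d j v) \<in> cocycles V d j"
        using that pot[of "d j v"] by (simp add: cocycles_def d_diff subspace_diff[OF subspace_V])
      from orthogonal_compD(1)[OF g this] show ?thesis by (simp add: inner_simps)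
    qed
    have bound: "\<bar>inner g (pot b)\<bar> \<le> c * norm g * norm b" if "b \<in> d j ` V j" for b
    proof -
      have "norm (pot b) \<le> c * norm b" using c(2)[of "pot b"] pot[OF that] by simp
      then have "norm g * norm (pot b) \<le> norm g * (c * norm b)" by (rule mult_left_mono) simp
      then show ?thesis
        using Cauchy_Schwarz_ineq2[of g "pot b"] by (simp add: mult_ac)
    qed
    obtain r where r: "r \<in> d j ` V j" "\<And>b. b \<in> d j ` V j \<Longrightarrow> inner r b = inner g (pot b)"
    proof (rule riesz_representation[of "d j ` V j" "\<lambda>b. inner g (pot b)" "c * norm g"])
      show "subspace (d j ` V j)" "complete (d j ` V j)"
        using subspace_coboundaries[of "j + 1"] complete_coboundaries[of "j + 1"]
        by (simp_all add: cob)
      show "lin_on (d j ` V j) (\<lambda>b. inner g (pot b))"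
        unfolding lin_on_def
      proof (intro conjI ballI allI)
        fix a b assume "a \<in> d j ` V j" "b \<in> d j ` V j"
        then obtain v w where "v \<in> V j" "w \<in> V j" "a = d j v" "b = d j w" by blast
        then show "inner g (pot (a + b)) = inner g (pot a) + inner g (pot b)"
          using gpot[of "v + w"] by (simp add: d_add gpot subspace_add[OF subspace_V] inner_simps)
      next
        fix t a assume "a \<in> d j ` V j"
        then obtain v where "v \<in> V j" "a = d j v" by blast
        then show "inner g (pot (t *\<^sub>R a)) = t *\<^sub>R inner g (pot a)"
          using gpot[of "t *\<^sub>R v"] by (simp add: d_scale gpot subspace_mul[OF subspace_V] inner_simps)
      qed
    qed (use bound in auto)
    have "inner r r \<le> (c * norm g) * norm r" using bound[OF r(1)] r(2)[OF r(1)] by simp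
    then have "norm r \<le> c * norm g" using c(1) by (intro norm_le_if_inner_le) auto
    then show ?thesis using r gpot by (auto simp: cob)
  qed
  with c(1) show ?thesis by (rule that)
qed

text \<open>Hodge decomposition of the cocycles: subtracting the projection onto the coboundaries,
  which exists by closed range, leaves a harmonic field, here orthogonal to itself.\<close>

lemma cocycle_perp_harmonics:
  assumes "u \<in> cocycles V d j" "\<And>q. q \<in> harmonics V d j \<Longrightarrow> inner u q = 0"
  shows "u \<in> coboundaries V d j"
proof -
  define b where "b = orth_proj (coboundaries V d j) u"
  have b: "b \<in> coboundaries V d j" "u - b \<in> (coboundaries V d j)\<^sup>\<bottom>"
    unfolding b_def using orth_proj_complete[OF subspace_coboundaries complete_coboundaries] by auto
  then have "u - b \<in> harmonics V d j"
    using assms(1) coboundaries_subset_cocycles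
    by (auto simp: harmonics_def intro: subspace_diff[OF subspace_cocycles])
  then have "inner u (u - b) = 0" "inner b (u - b) = 0"
    using assms(2) orthogonal_compD(2)[OF b(2,1)] by auto
  then have "inner (u - b) (u - b) = 0" by (simp add: inner_diff_left)
  then show ?thesis using b(1) by simp
qed

lemma perp_cocyclesI:
  assumes "u \<in> (coboundaries V d j)\<^sup>\<bottom>" "u \<in> (harmonics V d j)\<^sup>\<bottom>"
  shows "u \<in> (cocycles V d j)\<^sup>\<bottom>"
  unfolding mem_orthogonal_comp
proof
  fix z assume z: "z \<in> cocycles V d j"
  define b where "b = orth_proj (coboundaries V d j) z"
  have b: "b \<in> coboundaries V d j" "z - b \<in> (coboundaries V d j)\<^sup>\<bottom>"
    unfolding b_def using orth_proj_complete[OF subspace_coboundaries complete_coboundaries] by auto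
  then have "z - b \<in> harmonics V d j"
    using z coboundaries_subset_cocycles
    by (auto simp: harmonics_def intro: subspace_diff[OF subspace_cocycles])
  then have "inner u (z - b) = 0" "inner u b = 0"
    using assms b(1) by (auto intro: orthogonal_compD)
  then show "inner u z = 0" by (simp add: inner_diff_right)
qed

text \<open>With \<open>S = (d|\<^bsub>Z\<^sup>\<bottom>\<^esub>)\<^sup>-\<^sup>1\<close> the solution is \<open>\<sigma> = S P\<^bsub>B\<^esub> f\<close>,
  \<open>u = S\<^sup>* \<sigma> + S S\<^sup>* (I - P\<^bsub>Z\<^esub>) f\<close>, \<open>p = P\<^bsub>H\<^esub> f\<close>.\<close>
lemma mixed_solution_exists:
  obtains c where "0 \<le> c" "\<And>f. f \<in> W j \<Longrightarrow> \<exists>\<sigma> u p. mixed_solution V d j f \<sigma> u p \<and>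
    norm \<sigma> \<le> c * norm f \<and> norm u \<le> c * norm f \<and> norm (d j u) \<le> c * norm f"
proof -
  obtain a where a: "0 \<le> a"
    "\<And>v. v \<in> V (j - 1) \<Longrightarrow> v \<in> (cocycles V d (j - 1))\<^sup>\<bottom> \<Longrightarrow> norm v \<le> a * norm (d (j - 1) v)"
    by (rule poincare[of "j - 1"]) blast
  obtain b where b: "0 \<le> b"
    "\<And>v. v \<in> V j \<Longrightarrow> v \<in> (cocycles V d j)\<^sup>\<bottom> \<Longrightarrow> norm v \<le> b * norm (d j v)"
    by (rule poincare[of j]) blast
  obtain a' where a': "0 \<le> a'" "\<And>g. g \<in> (cocycles V d (j - 1))\<^sup>\<bottom> \<Longrightarrow>
    \<exists>r\<in>coboundaries V d j. norm r \<le> a' * norm g \<and> (\<forall>v\<in>V (j - 1). inner r (d (j - 1) v) = inner g v)"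
    by (rule exact_lift[of "j - 1"]) simp
  obtain b' where b': "0 \<le> b'" "\<And>g. g \<in> (cocycles V d j)\<^sup>\<bottom> \<Longrightarrow>
    \<exists>r\<in>coboundaries V d (j + 1). norm r \<le> b' * norm g \<and> (\<forall>v\<in>V j. inner r (d j v) = inner g v)"
    by (rule exact_lift[of j]) blast
  \<comment> \<open>The three entries bound \<sigma>, \<open>d j u\<close> and \<open>u\<close>, in
    this order.\<close>
  define c where "c = max (max a b') (a' * a + b * b')"
  have c: "a \<le> c" "b' \<le> c" "a' * a + b * b' \<le> c" by (auto simp: c_def)
  have "\<exists>\<sigma> u p. mixed_solution V d j f \<sigma> u p \<and>
    norm \<sigma> \<le> c * norm f \<and> norm u \<le> c * norm f \<and> norm (d j u) \<le> c * norm f" for f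
  proof -
    define fB where "fB = orth_proj (coboundaries V d j) f"
    have fB: "fB \<in> coboundaries V d j" "f - fB \<in> (coboundaries V d j)\<^sup>\<bottom>"
      unfolding fB_def using orth_proj_complete[OF subspace_coboundaries complete_coboundaries] by auto
    have fB_le: "norm fB \<le> norm f"
      unfolding fB_def by (rule norm_orth_proj_le[OF subspace_coboundaries complete_coboundaries])
    define g where "g = coexact_part j f"
    have g: "g \<in> (cocycles V d j)\<^sup>\<bottom>" "norm g \<le> norm f" "f - g \<in> cocycles V d j"
      by (simp_all add: g_def coexact_part_perp norm_coexact_part_le coexact_part_diff_cocycle)
    define p where "p = f - g - fB"
    have "g \<in> (coboundaries V d j)\<^sup>\<bottom>"
      using g(1) coboundaries_subset_cocycles by (auto simp: mem_orthogonal_comp)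
    then have "(f - fB) - g \<in> (coboundaries V d j)\<^sup>\<bottom>"
      using fB(2) subspace_diff[OF subspace_orthogonal_comp] by blast
    moreover have "p \<in> cocycles V d j"
      unfolding p_def using g(3) fB(1) coboundaries_subset_cocycles
      by (auto intro: subspace_diff[OF subspace_cocycles])
    ultimately have pH: "p \<in> harmonics V d j" by (simp add: harmonics_def p_def algebra_simps)
    obtain \<sigma>0 where "\<sigma>0 \<in> V (j - 1)" "d (j - 1) \<sigma>0 = fB"
      using fB(1) by (auto simp: coboundaries_def)
    then obtain \<sigma> where s: "\<sigma> \<in> V (j - 1)" "\<sigma> \<in> (cocycles V d (j - 1))\<^sup>\<bottom>" "d (j - 1) \<sigma> = fB"
      by (metis coexact_part_in coexact_part_perp d_coexact_part)
    \<comment> \<open>The exact part \<open>u1\<close> solves \<open>d* u1 = \<sigma>\<close>. The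
      coexact part \<open>u2\<close> is found in two stages, \<open>d* r = g\<close> and then
      \<open>d u2 = r\<close>.\<close>
    obtain u1 where u1: "u1 \<in> coboundaries V d j" "norm u1 \<le> a' * norm \<sigma>"
      "\<And>v. v \<in> V (j - 1) \<Longrightarrow> inner u1 (d (j - 1) v) = inner \<sigma> v" using a'(2)[OF s(2)] by blast
    obtain r where r: "r \<in> coboundaries V d (j + 1)" "norm r \<le> b' * norm g"
      "\<And>v. v \<in> V j \<Longrightarrow> inner r (d j v) = inner g v" using b'(2)[OF g(1)] by blast
    obtain w where "w \<in> V j" "d j w = r" using r(1) by (auto simp: coboundaries_def)
    then obtain u2 where u2: "u2 \<in> V j" "u2 \<in> (cocycles V d j)\<^sup>\<bottom>" "d j u2 = r"
      by (metis coexact_part_in coexact_part_perp d_coexact_part)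
    have u1Z: "u1 \<in> V j" "d j u1 = 0"
      using u1(1) coboundaries_subset_cocycles by (auto simp: cocycles_def)
    have du: "d j (u1 + u2) = r" using u1Z u2 by (simp add: d_add)
    have "mixed_solution V d j f \<sigma> (u1 + u2) p"
      unfolding mixed_solution_def
    proof (intro conjI ballI)
      fix \<tau> assume t: "\<tau> \<in> V (j - 1)"
      have "inner (d (j - 1) \<tau>) u2 = 0"
        using coboundariesI[OF t] coboundaries_subset_cocycles orthogonal_compD(2)[OF u2(2)] by blast
      then show "inner \<sigma> \<tau> - inner (d (j - 1) \<tau>) (u1 + u2) = 0"
        using u1(3)[OF t] by (simp add: inner_simps inner_commute)
    next
      fix v assume "v \<in> V j"
      then show "inner (d (j - 1) \<sigma>) v + inner (d j (u1 + u2)) (d j v) + inner v p = inner f v"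
        by (simp add: du s(3) r(3) p_def inner_simps inner_commute)
    next
      fix q assume q: "q \<in> harmonics V d j"
      have "inner u1 q = 0" using harmonicsD(2)[OF q] u1(1) by (rule orthogonal_compD)
      moreover have "inner u2 q = 0" using u2(2) harmonicsD(1)[OF q] by (rule orthogonal_compD)
      ultimately show "inner (u1 + u2) q = 0" by (simp add: inner_simps)
    qed (use s u1Z u2 pH in \<open>auto intro: subspace_add[OF subspace_V]\<close>)
    moreover have sa: "norm \<sigma> \<le> a * norm f"
      using a(2)[OF s(1,2)] mult_left_mono[OF fB_le a(1)] by (simp add: s(3))
    moreover have rb: "norm r \<le> b' * norm f"
      using r(2) mult_left_mono[OF g(2) b'(1)] by simp
    moreover have "norm u1 \<le> a' * a * norm f"
      using u1(2) mult_left_mono[OF sa a'(1)] by (simp add: mult.assoc)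
    moreover have "norm u2 \<le> b * b' * norm f"
      using b(2)[OF u2(1,2)] mult_left_mono[OF rb b(1)] by (simp add: mult.assoc u2(3))
    then have "norm (u1 + u2) \<le> (a' * a + b * b') * norm f"
      using \<open>norm u1 \<le> a' * a * norm f\<close> norm_triangle_ineq[of u1 u2] by (simp add: algebra_simps)
    ultimately have "mixed_solution V d j f \<sigma> (u1 + u2) p \<and>
      norm \<sigma> \<le> c * norm f \<and> norm (u1 + u2) \<le> c * norm f \<and> norm (d j (u1 + u2)) \<le> c * norm f"
      using mult_right_mono[OF c(1), of "norm f"] mult_right_mono[OF c(2), of "norm f"]
        mult_right_mono[OF c(3), of "norm f"] by (simp add: du)
    then show ?thesis by blast
  qed
  moreover have "0 \<le> c" using a(1) c(1) by simp
  ultimately show ?thesis by (intro that[of c])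
qed

section \<open>The solution operator on exact and coexact data\<close>

abbreviation K :: "int \<Rightarrow> 'a \<Rightarrow> 'a" where
  "K j \<equiv> solution_op V d j"

text \<open>The first mixed equation is the defining relation of the adjoint, so \<open>d* K\<close>
  is the map from the data to \<sigma>.\<close>

lemma solution_op_eq:
  assumes "mixed_solution V d j f \<sigma> u p"
  shows "K j f = u" "adj W V d j (K j f) = \<sigma>"
proof -
  show Ku: "K j f = u"
    unfolding solution_op_def using assms mixed_solution_unique(2) by blast
  show "adj W V d j (K j f) = \<sigma>"
    unfolding Ku using assms V_in_W
    by (intro adj_eqI) (auto simp: mixed_solution_def inner_commute)
qed

lemma solution_op_bounded:
  obtains c where "0 \<le> c" "\<And>f. f \<in> W j \<Longrightarrow>
    norm (K j f) \<le> c * norm f \<and> norm (d j (K j f)) \<le> c * norm f \<and>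
    norm (adj W V d j (K j f)) \<le> c * norm f"
proof -
  obtain c where "0 \<le> c" "\<And>f. f \<in> W j \<Longrightarrow> \<exists>\<sigma> u p. mixed_solution V d j f \<sigma> u p \<and>
    norm \<sigma> \<le> c * norm f \<and> norm u \<le> c * norm f \<and> norm (d j u) \<le> c * norm f"
    by (rule mixed_solution_exists[of j]) blast
  then show ?thesis using solution_op_eq by (intro that[of c]) blast+
qed

lemma solution_op_in:
  assumes "f \<in> W j"
  shows "K j f \<in> V j" "adj W V d j (K j f) \<in> V (j - 1)"
proof -
  obtain \<sigma> u p where sol: "mixed_solution V d j f \<sigma> u p"
    using mixed_solution_exists[of j] assms by metis
  then show "K j f \<in> V j" "adj W V d j (K j f) \<in> V (j - 1)"
    using solution_op_eq[OF sol] by (simp_all add: mixed_solution_def)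
qed

text \<open>For exact data the problem reduces to \<open>d d* u = f\<close>: testing with
  \<open>f - d \<sigma>\<close> shows \<open>d \<sigma> = f\<close>, whence \<open>p\<close> and
  \<open>d u\<close> vanish. Thus \<open>d* K\<close> yields the coexact potential of a
  coboundary.\<close>

lemma solution_op_coboundary:
  assumes "f \<in> coboundaries V d j"
  shows "K j f \<in> coboundaries V d j"
    and "adj W V d j (K j f) \<in> (cocycles V d (j - 1))\<^sup>\<bottom>"
    and "d (j - 1) (adj W V d j (K j f)) = f"
    and "\<tau> \<in> V (j - 1) \<Longrightarrow> inner (adj W V d j (K j f)) \<tau> = inner (d (j - 1) \<tau>) (K j f)"
proof -
  have fZ: "f \<in> cocycles V d j" using assms coboundaries_subset_cocycles by blast
  then have "f \<in> W j" by (simp add: cocyclesD V_in_W)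
  then obtain \<sigma> u p where sol: "mixed_solution V d j f \<sigma> u p"
    using mixed_solution_exists[of j] by metis
  note K = solution_op_eq[OF sol]
  note eqs = sol[unfolded mixed_solution_def]
  have sV: "\<sigma> \<in> V (j - 1)" and uV: "u \<in> V j" and pH: "p \<in> harmonics V d j" using eqs by auto
  have e2: "inner (d (j - 1) \<sigma>) v + inner (d j u) (d j v) + inner v p = inner f v" if "v \<in> V j" for v
    using eqs that by auto
  have e1: "inner \<sigma> \<tau> = inner (d (j - 1) \<tau>) u" if "\<tau> \<in> V (j - 1)" for \<tau>
    using eqs that by auto
  have diff: "f - d (j - 1) \<sigma> \<in> coboundaries V d j"
    using assms coboundariesI[OF sV] by (rule subspace_diff[OF subspace_coboundaries])
  then have "f - d (j - 1) \<sigma> \<in> cocycles V d j" using coboundaries_subset_cocycles by blast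
  then have "inner (d (j - 1) \<sigma>) (f - d (j - 1) \<sigma>) = inner f (f - d (j - 1) \<sigma>)"
    using e2[of "f - d (j - 1) \<sigma>"] orthogonal_compD(2)[OF harmonicsD(2)[OF pH] diff]
    by (simp add: cocyclesD)
  then have "inner (f - d (j - 1) \<sigma>) (f - d (j - 1) \<sigma>) = 0" by (simp add: inner_diff_left)
  then have ds: "d (j - 1) \<sigma> = f" by simp
  have "inner p p = 0" using e2[of p] ds harmonicsD(1)[OF pH] by (simp add: cocyclesD)
  then have "d j u = 0" using e2[OF uV] ds by simp
  then show "K j f \<in> coboundaries V d j"
    unfolding K using eqs by (intro cocycle_perp_harmonics) (auto simp: cocycles_def)
  show "adj W V d j (K j f) \<in> (cocycles V d (j - 1))\<^sup>\<bottom>"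
    unfolding K(2) using e1 by (auto simp: mem_orthogonal_comp cocycles_def)
  show "d (j - 1) (adj W V d j (K j f)) = f" unfolding K(2) by (rule ds)
  show "inner (adj W V d j (K j f)) \<tau> = inner (d (j - 1) \<tau>) (K j f)" if "\<tau> \<in> V (j - 1)"
    unfolding K(2) unfolding K(1) by (rule e1[OF that])
qed

text \<open>For coexact data \<sigma> and \<open>p\<close> vanish and the problem reduces to
  \<open>d* d u = f\<close>. This is the dual problem in the estimates of \<sigma> and
  \<open>u\<close>.\<close>

lemma solution_op_coexact:
  assumes f: "f \<in> W j" "f \<in> (cocycles V d j)\<^sup>\<bottom>"
  shows "K j f \<in> (cocycles V d j)\<^sup>\<bottom>"
    and "v \<in> V j \<Longrightarrow> inner (d j (K j f)) (d j v) = inner f v"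
proof -
  obtain \<sigma> u p where sol: "mixed_solution V d j f \<sigma> u p"
    using mixed_solution_exists[of j] f(1) by metis
  note K = solution_op_eq(1)[OF sol]
  note eqs = sol[unfolded mixed_solution_def]
  have sV: "\<sigma> \<in> V (j - 1)" and pH: "p \<in> harmonics V d j" using eqs by auto
  have e2: "inner (d (j - 1) \<sigma>) v + inner (d j u) (d j v) + inner v p = inner f v" if "v \<in> V j" for v
    using eqs that by auto
  have dsZ: "d (j - 1) \<sigma> \<in> cocycles V d j"
    using coboundariesI[OF sV] coboundaries_subset_cocycles by blast
  have dsp: "inner (d (j - 1) \<sigma>) p = 0"
    using orthogonal_compD(2)[OF harmonicsD(2)[OF pH] coboundariesI[OF sV]] .
  have ds: "d (j - 1) \<sigma> = 0"
    using e2[of "d (j - 1) \<sigma>"] dsZ dsp orthogonal_compD(1)[OF f(2) dsZ] by (simp add: cocyclesD)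
  have p: "p = 0"
    using e2[of p] ds harmonicsD(1)[OF pH] orthogonal_compD(1)[OF f(2), of p]
    by (simp add: cocyclesD)
  have "inner \<sigma> \<sigma> - inner (d (j - 1) \<sigma>) u = 0" using eqs sV by blast
  then have "\<sigma> = 0" using ds by simp
  then have "u \<in> (coboundaries V d j)\<^sup>\<bottom>"
    using eqs by (auto simp: coboundaries_def mem_orthogonal_comp inner_commute)
  then show "K j f \<in> (cocycles V d j)\<^sup>\<bottom>"
    unfolding K using eqs by (intro perp_cocyclesI) (auto simp: mem_orthogonal_comp)
  show "inner (d j (K j f)) (d j v) = inner f v" if "v \<in> V j"
    unfolding K using e2[OF that] ds p by simp
qed

end

section \<open>Discretization\<close>

text \<open>One fixed discretization; uniformity in the parameter is carried by \<open>M\<close>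
  alone. The bound concerns \<open>I - \<pi>\<close> in three degrees only, because the norms of the
  projections may vary with the degree.\<close>

locale discretized_hilbert_complex = compact_hilbert_complex W V d
  for W V :: "int \<Rightarrow> 'a::real_inner set" and d :: "int \<Rightarrow> 'a \<Rightarrow> 'a" +
  fixes Vh :: "int \<Rightarrow> 'a set" and \<pi> :: "int \<Rightarrow> 'a \<Rightarrow> 'a" and k :: int and M :: real
  assumes subcomplex: "finite_dim_subcomplex V d Vh"
    and proj_linear: "lin_on (W j) (\<pi> j)"
    and proj_in: "w \<in> W j \<Longrightarrow> \<pi> j w \<in> Vh j"
    and proj_id: "v \<in> Vh j \<Longrightarrow> \<pi> j v = v"
    and proj_d: "v \<in> V j \<Longrightarrow> d j (\<pi> j v) = \<pi> (j + 1) (d j v)"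
    and M_pos: "0 < M"
    and proj_bound: "j \<in> {k - 1, k, k + 1} \<Longrightarrow> w \<in> W j \<Longrightarrow> norm (w - \<pi> j w) \<le> M * norm w"
begin

section \<open>Discrete subspaces and commuting projections\<close>

lemma Vh_in: "v \<in> Vh j \<Longrightarrow> v \<in> V j"
  and d_Vh: "v \<in> Vh j \<Longrightarrow> d j v \<in> Vh (j + 1)"
  and Vh_span: "\<exists>B. finite B \<and> Vh j = span B"
  using subcomplex by (auto simp: finite_dim_subcomplex_def)

lemma subspace_Vh: "subspace (Vh j)"
  using Vh_span[of j] by auto

lemma proj_diff: "v \<in> W j \<Longrightarrow> w \<in> W j \<Longrightarrow> \<pi> j (v - w) = \<pi> j v - \<pi> j w"
  by (rule lin_on_diff[OF proj_linear subspace_W])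

text \<open>Whatever is orthogonal to the discrete coboundaries cannot distinguish a coboundary
  \<open>b\<close> from \<open>b - \<pi> j b\<close>; this is how \<open>I - \<pi>\<close> is
  inserted.\<close>

lemma d_proj:
  assumes "v \<in> V (j - 1)"
  shows "\<pi> j (d (j - 1) v) \<in> coboundaries Vh d j"
  unfolding coboundaries_def
  by (rule image_eqI[OF _ proj_in[OF V_in_W[OF assms]]]) (use proj_d[OF assms] in simp)

lemma coboundaries_Vh_subset: "coboundaries Vh d j \<subseteq> coboundaries V d j"
  using Vh_in by (auto simp: coboundaries_def)

lemma cocycles_Vh_subset: "cocycles Vh d j \<subseteq> cocycles V d j"
  using Vh_in by (auto simp: cocycles_def)

lemma coboundaries_Vh_subset_cocycles: "coboundaries Vh d j \<subseteq> cocycles Vh d j"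
  using d_Vh[of _ "j - 1"] d_d[of _ "j - 1"] Vh_in by (auto simp: coboundaries_def cocycles_def)

lemma cocycles_Vh_in: "v \<in> cocycles Vh d j \<Longrightarrow> v \<in> Vh j"
  by (simp add: cocycles_def)

lemma subspace_cocycles_Vh: "subspace (cocycles Vh d j)"
  using subspace_Vh[of j] Vh_in by (auto simp: subspace_def cocycles_def d_add d_scale d_0)

lemma subspace_coboundaries_Vh: "subspace (coboundaries Vh d j)"
proof (rule subspaceI)
  note S = subspace_Vh[of "j - 1"]
  have I: "d (j - 1) v \<in> coboundaries Vh d j" if "v \<in> Vh (j - 1)" for v
    using that by (auto simp: coboundaries_def)
  show "0 \<in> coboundaries Vh d j"
    using I[OF subspace_0[OF S]] by (simp add: d_0)
  fix x assume "x \<in> coboundaries Vh d j"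
  then obtain v where v: "v \<in> Vh (j - 1)" "x = d (j - 1) v" by (auto simp: coboundaries_def)
  show "c *\<^sub>R x \<in> coboundaries Vh d j" for c
    using I[OF subspace_mul[OF S v(1)]] v by (simp add: d_scale Vh_in)
  fix y assume "y \<in> coboundaries Vh d j"
  then obtain w where w: "w \<in> Vh (j - 1)" "y = d (j - 1) w" by (auto simp: coboundaries_def)
  show "x + y \<in> coboundaries Vh d j"
    using I[OF subspace_add[OF S v(1) w(1)]] v w by (simp add: d_add Vh_in)
qed

lemma orth_proj_cocycles_Vh:
  "orth_proj (cocycles Vh d j) x \<in> cocycles Vh d j"
  "x - orth_proj (cocycles Vh d j) x \<in> (cocycles Vh d j)\<^sup>\<bottom>"
proof -
  obtain B where "finite B" "Vh j = span B" using Vh_span by blast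
  then show "orth_proj (cocycles Vh d j) x \<in> cocycles Vh d j"
    "x - orth_proj (cocycles Vh d j) x \<in> (cocycles Vh d j)\<^sup>\<bottom>"
    using orth_proj_finite_dim[OF subspace_cocycles_Vh, of j B x] cocycles_Vh_in by auto
qed

lemma orth_proj_coboundaries_Vh:
  "orth_proj (coboundaries Vh d j) x \<in> coboundaries Vh d j"
  "x - orth_proj (coboundaries Vh d j) x \<in> (coboundaries Vh d j)\<^sup>\<bottom>"
proof -
  obtain B where "finite B" "Vh j = span B" using Vh_span by blast
  then show "orth_proj (coboundaries Vh d j) x \<in> coboundaries Vh d j"
    "x - orth_proj (coboundaries Vh d j) x \<in> (coboundaries Vh d j)\<^sup>\<bottom>"
    using orth_proj_finite_dim[OF subspace_coboundaries_Vh, of j B x]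
      coboundaries_Vh_subset_cocycles[of j] cocycles_Vh_in[of _ j] by blast+
qed

text \<open>\<open>I - \<pi>\<close> annihilates \<open>Vh j\<close>, so any discrete
  \<open>v\<close> may be subtracted from \<open>w\<close> first.\<close>

lemma proj_error_le_infdist:
  assumes "j \<in> {k - 1, k, k + 1}" "w \<in> W j"
  shows "norm (w - \<pi> j w) \<le> M * infdist w (Vh j)"
proof -
  have ne: "Vh j \<noteq> {}" using subspace_0[OF subspace_Vh] by blast
  have "norm (w - \<pi> j w) / M \<le> dist w v" if v: "v \<in> Vh j" for v
  proof -
    have vW: "v \<in> W j" using v by (simp add: Vh_in V_in_W)
    have "norm ((w - v) - \<pi> j (w - v)) \<le> M * norm (w - v)"
      using assms vW by (intro proj_bound subspace_diff[OF subspace_W])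
    then show ?thesis
      using M_pos by (simp add: proj_diff[OF assms(2) vW] proj_id[OF v] divide_le_eq dist_norm mult.commute)
  qed
  then have "norm (w - \<pi> j w) / M \<le> infdist w (Vh j)"
    using ne unfolding infdist_def by (auto intro: cINF_greatest)
  then show ?thesis using M_pos by (simp add: divide_le_eq mult.commute)
qed

section \<open>Projection errors bounded by \<eta>, \<delta> and \<mu>\<close>

abbreviation "\<eta> \<equiv> eta W V d \<pi> k"
abbreviation "\<delta> \<equiv> delta W V d \<pi> k"
abbreviation "\<mu> \<equiv> mu W V d \<pi> k"

lemma proj_compose_bounded:
  assumes "j \<in> {k - 1, k, k + 1}"
    and "\<And>f. f \<in> S \<Longrightarrow> T f \<in> W j" "\<And>f. f \<in> S \<Longrightarrow> norm (T f) \<le> c * norm f" "f \<in> S"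
  shows "norm (T f - \<pi> j (T f)) \<le> M * c * norm f"
proof -
  have "M * norm (T f) \<le> M * (c * norm f)"
    using assms(3)[OF assms(4)] M_pos by (intro mult_left_mono) auto
  then show ?thesis using proj_bound[OF assms(1) assms(2)[OF assms(4)]] by (simp add: mult.assoc)
qed

lemma W_nonempty: "W j \<noteq> {}"
  using subspace_0[OF subspace_W] by blast

text \<open>The degrees match the use: \<open>d K\<close> in degrees \<open>k - 1\<close> and
  \<open>k\<close> for the dual problems of \<sigma> and \<open>u\<close>, \<open>d* K\<close> in
  degrees \<open>k\<close> and \<open>k + 1\<close> for potentials of coboundaries.\<close>

lemma eta_ge:
  "j \<in> {k - 1, k} \<Longrightarrow> d_solution_error W V d \<pi> j \<le> \<eta>"
  "j \<in> {k, k + 1} \<Longrightarrow> adj_solution_error W V d \<pi> j \<le> \<eta>"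
  unfolding eta_def by (intro Max_ge; force)+

lemma d_solution_op_error_bounded:
  assumes "j \<in> {k - 1, k}"
  obtains c where "0 \<le> c" "\<And>f. f \<in> W j \<Longrightarrow>
    norm (d j (K j f) - \<pi> (j + 1) (d j (K j f))) \<le> c * norm f"
proof -
  obtain c where c: "0 \<le> c" "\<And>f. f \<in> W j \<Longrightarrow> norm (d j (K j f)) \<le> c * norm f"
    by (rule solution_op_bounded[of j]) blast
  have "norm (d j (K j f) - \<pi> (j + 1) (d j (K j f))) \<le> M * c * norm f" if "f \<in> W j" for f
    by (rule proj_compose_bounded[of "j + 1" "W j"])
      (use assms that c solution_op_in in \<open>auto intro: d_in_W\<close>)
  moreover have "0 \<le> M * c" using M_pos c(1) by simp
  ultimately show ?thesis by (rule that[rotated])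
qed

lemma d_solution_op_error:
  assumes "j \<in> {k - 1, k}" and f: "f \<in> W j"
  shows "norm (d j (K j f) - \<pi> (j + 1) (d j (K j f))) \<le> \<eta> * norm f"
proof (rule d_solution_op_error_bounded[OF assms(1)])
  fix c :: real
  assume c: "0 \<le> c" "\<And>f. f \<in> W j \<Longrightarrow>
    norm (d j (K j f) - \<pi> (j + 1) (d j (K j f))) \<le> c * norm f"
  have "norm (d j (K j f) - \<pi> (j + 1) (d j (K j f))) \<le> d_solution_error W V d \<pi> j * norm f"
    unfolding d_solution_error_def by (rule le_onorm_on[OF c(2,1) f])
  also have "\<dots> \<le> \<eta> * norm f" using eta_ge(1)[OF assms(1)] by (rule mult_right_mono) simp
  finally show ?thesis .
qed

lemma eta_nonneg: "0 \<le> \<eta>"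
proof (rule d_solution_op_error_bounded[of k])
  fix c :: real
  assume "0 \<le> c" "\<And>f. f \<in> W k \<Longrightarrow>
    norm (d k (K k f) - \<pi> (k + 1) (d k (K k f))) \<le> c * norm f"
  then have "0 \<le> d_solution_error W V d \<pi> k"
    unfolding d_solution_error_def by (intro onorm_on_nonneg[OF _ _ W_nonempty])
  then show ?thesis using eta_ge(1)[of k] by simp
qed simp

lemma adj_solution_op_error:
  assumes j: "j \<in> {k, k + 1}" and f: "f \<in> W j"
  shows "norm (adj W V d j (K j f) - \<pi> (j - 1) (adj W V d j (K j f))) \<le> \<eta> * norm f"
proof -
  obtain c where c: "0 \<le> c" "\<And>f. f \<in> W j \<Longrightarrow> norm (adj W V d j (K j f)) \<le> c * norm f"
    by (rule solution_op_bounded[of j]) blast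
  have *: "norm (adj W V d j (K j f) - \<pi> (j - 1) (adj W V d j (K j f))) \<le> M * c * norm f"
    if "f \<in> W j" for f
    by (rule proj_compose_bounded[of "j - 1" "W j"])
      (use j that c solution_op_in V_in_W in auto)
  have Mc: "0 \<le> M * c" using M_pos c(1) by simp
  have "norm (adj W V d j (K j f) - \<pi> (j - 1) (adj W V d j (K j f)))
      \<le> adj_solution_error W V d \<pi> j * norm f"
    unfolding adj_solution_error_def by (rule le_onorm_on[OF * Mc f])
  then show ?thesis
    using mult_right_mono[OF eta_ge(2)[OF j], of "norm f"] by simp
qed

lemma solution_op_error:
  shows "f \<in> W k \<Longrightarrow> norm (K k f - \<pi> k (K k f)) \<le> \<delta> * norm f"
    and delta_nonneg: "0 \<le> \<delta>"
proof -
  obtain c where c: "0 \<le> c" "\<And>f. f \<in> W k \<Longrightarrow> norm (K k f) \<le> c * norm f"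
    by (rule solution_op_bounded[of k]) blast
  have *: "norm (K k f - \<pi> k (K k f)) \<le> M * c * norm f" if "f \<in> W k" for f
    by (rule proj_compose_bounded[of k "W k"]) (use that c solution_op_in V_in_W in auto)
  have Mc: "0 \<le> M * c" using M_pos c(1) by simp
  show "norm (K k f - \<pi> k (K k f)) \<le> \<delta> * norm f" if "f \<in> W k"
    unfolding delta_def by (rule le_onorm_on[OF * Mc that])
  show "0 \<le> \<delta>" unfolding delta_def by (rule onorm_on_nonneg[OF * Mc W_nonempty])
qed

abbreviation "PH \<equiv> orth_proj (harmonics V d k)"

text \<open>The crude bound \<open>mu_le\<close> later removes \<mu> from the estimate of the
  residual.\<close>

lemma harmonic_proj_error:
  shows "f \<in> W k \<Longrightarrow> norm (PH f - \<pi> k (PH f)) \<le> \<mu> * norm f"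
    and mu_nonneg: "0 \<le> \<mu>"
    and mu_le: "\<mu> \<le> M"
proof -
  have PW: "PH f \<in> W k" for f
    using orth_proj_in[OF subspace_harmonics complete_harmonics] harmonicsD(1) cocyclesD(1) V_in_W
    by blast
  have *: "norm (PH f - \<pi> k (PH f)) \<le> M * norm f" if "f \<in> W k" for f
    using proj_compose_bounded[of k "W k" PH 1] PW that
      norm_orth_proj_le(1)[OF subspace_harmonics complete_harmonics] by simp
  have M0: "0 \<le> M" using M_pos by simp
  show "norm (PH f - \<pi> k (PH f)) \<le> \<mu> * norm f" if "f \<in> W k"
    unfolding mu_def by (rule le_onorm_on[OF * M0 that])
  show "0 \<le> \<mu>" unfolding mu_def by (rule onorm_on_nonneg[OF * M0 W_nonempty])
  show "\<mu> \<le> M" unfolding mu_def by (rule onorm_on_le[OF * M0 W_nonempty])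
qed

text \<open>The difference \<open>vh - \<pi> v\<close> is a discrete cocycle, hence orthogonal to \<open>vh - v\<close>.\<close>
lemma discrete_coexact_error:
  assumes vh: "vh \<in> Vh j" "vh \<in> (cocycles Vh d j)\<^sup>\<bottom>"
  defines "v \<equiv> coexact_part j vh"
  shows "norm (vh - v) \<le> norm (v - \<pi> j v)"
    and "j \<in> {k - 1, k} \<Longrightarrow> norm (vh - v) \<le> \<eta> * norm (d j vh)"
proof -
  have v: "v \<in> V j" "v \<in> (cocycles V d j)\<^sup>\<bottom>" "d j v = d j vh"
    unfolding v_def using Vh_in[OF vh(1)]
    by (simp_all add: coexact_part_in coexact_part_perp d_coexact_part)
  have pv: "\<pi> j v \<in> Vh j" by (rule proj_in[OF V_in_W[OF v(1)]])
  have "d j (\<pi> j v) = d j vh"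
    using proj_d[OF v(1)] proj_id[OF d_Vh[OF vh(1)]] v(3) by simp
  then have Zh: "vh - \<pi> j v \<in> cocycles Vh d j"
    using vh(1) pv by (simp add: cocycles_def d_diff Vh_in subspace_diff[OF subspace_Vh])
  then have "vh - \<pi> j v \<in> cocycles V d j" using cocycles_Vh_subset by blast
  then have "inner vh (vh - \<pi> j v) = 0" "inner v (vh - \<pi> j v) = 0"
    using orthogonal_compD(1)[OF vh(2) Zh] orthogonal_compD(1)[OF v(2)] by simp_all
  then have "inner (v - vh) (vh - \<pi> j v) = 0" by (simp add: inner_diff_left)
  from norm_le_norm_add_if_orthogonal[OF this]
  show le: "norm (vh - v) \<le> norm (v - \<pi> j v)" by (simp add: norm_minus_commute)
  show "norm (vh - v) \<le> \<eta> * norm (d j vh)" if j: "j \<in> {k - 1, k}"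
  proof -
    have cob: "d j vh \<in> coboundaries V d (j + 1)"
      using Vh_in[OF vh(1)] by (auto simp: coboundaries_def)
    define w where "w = adj W V d (j + 1) (K (j + 1) (d j vh))"
    have "w \<in> V j" "w \<in> (cocycles V d j)\<^sup>\<bottom>" "d j w = d j vh"
      using solution_op_coboundary(2,3)[OF cob] solution_op_in(2)[OF d_in_W[OF Vh_in[OF vh(1)]]]
      by (simp_all add: w_def)
    then have "w = v" using v by (metis perp_cocycles_unique)
    \<comment> \<open>The dual problem lives one degree higher, so \<open>j\<close> in
      \<open>{k - 1, k}\<close> meets the degrees \<open>k\<close> and \<open>k + 1\<close> of
      \<open>d* K\<close> in \<eta>.\<close>
    moreover have "norm (w - \<pi> (j + 1 - 1) w) \<le> \<eta> * norm (d j vh)"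
      unfolding w_def using j d_in_W[OF Vh_in[OF vh(1)]] by (intro adj_solution_op_error) auto
    ultimately show ?thesis using le by simp
  qed
qed

text \<open>Since \<open>q - \<pi> (PH q)\<close> is a discrete coboundary, it is orthogonal to \<open>q - PH q\<close>.\<close>
lemma discrete_harmonic_error:
  assumes q: "q \<in> harmonics Vh d k"
  shows "q - PH q \<in> coboundaries V d k" and "norm (q - PH q) \<le> \<mu> * norm q"
proof -
  have qZh: "q \<in> cocycles Vh d k" and qB: "q \<in> (coboundaries Vh d k)\<^sup>\<bottom>"
    using q by (auto simp: harmonics_def)
  then have qZ: "q \<in> cocycles V d k" using cocycles_Vh_subset by blast
  note P = orth_proj_complete[OF subspace_harmonics[of k] complete_harmonics, of q]
  have PZ: "PH q \<in> cocycles V d k" using P(1) harmonicsD(1) by blast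
  show cob: "q - PH q \<in> coboundaries V d k"
    using orthogonal_compD(1)[OF P(2)] subspace_diff[OF subspace_cocycles qZ PZ]
    by (intro cocycle_perp_harmonics) auto
  then obtain s where s: "s \<in> V (k - 1)" "q - PH q = d (k - 1) s" by (auto simp: coboundaries_def)
  \<comment> \<open>Since \<pi> fixes \<open>q\<close>, the vector in question is the projection of
    the coboundary \<open>q - PH q\<close>.\<close>
  have "\<pi> k (q - PH q) = q - \<pi> k (PH q)"
    using qZ PZ proj_id[OF cocycles_Vh_in[OF qZh]] by (simp add: proj_diff cocyclesD V_in_W)
  then have Bh: "q - \<pi> k (PH q) \<in> coboundaries Vh d k" using d_proj[OF s(1)] s(2) by simp
  then have "q - \<pi> k (PH q) \<in> coboundaries V d k" using coboundaries_Vh_subset by blast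
  then have "inner q (q - \<pi> k (PH q)) = 0" "inner (PH q) (q - \<pi> k (PH q)) = 0"
    using orthogonal_compD(1)[OF qB Bh] orthogonal_compD(1)[OF harmonicsD(2)[OF P(1)]] by simp_all
  then have "inner (PH q - q) (q - \<pi> k (PH q)) = 0" by (simp add: inner_diff_left)
  from norm_le_norm_add_if_orthogonal[OF this]
  have "norm (q - PH q) \<le> norm (PH q - \<pi> k (PH q))" by (simp add: norm_minus_commute)
  also have "\<dots> \<le> \<mu> * norm q" using qZ by (intro harmonic_proj_error(1)) (simp add: cocyclesD V_in_W)
  finally show "norm (q - PH q) \<le> \<mu> * norm q" .
qed

end

section \<open>Error estimates\<close>

context discretized_hilbert_complex
begin

context
  fixes f \<sigma> u p \<sigma>h uh ph
  assumes sol: "mixed_solution V d k f \<sigma> u p"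
    and sol_h: "mixed_solution Vh d k f \<sigma>h uh ph"
begin

section \<open>Errors of \<sigma> and \<open>p\<close>\<close>

lemma sol_in: "\<sigma> \<in> V (k - 1)" "u \<in> V k" "p \<in> harmonics V d k"
  "\<sigma>h \<in> Vh (k - 1)" "uh \<in> Vh k" "ph \<in> harmonics Vh d k"
  using sol sol_h by (auto simp: mixed_solution_def)

lemma sol_Vh_in_V: "\<sigma>h \<in> V (k - 1)" "uh \<in> V k"
  using sol_in Vh_in by auto

lemma sol_eqs:
  "\<tau> \<in> V (k - 1) \<Longrightarrow> inner \<sigma> \<tau> = inner (d (k - 1) \<tau>) u"
  "v \<in> V k \<Longrightarrow> inner (d (k - 1) \<sigma>) v + inner (d k u) (d k v) + inner v p = inner f v"
  "q \<in> harmonics V d k \<Longrightarrow> inner u q = 0"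
  "\<tau> \<in> Vh (k - 1) \<Longrightarrow> inner \<sigma>h \<tau> = inner (d (k - 1) \<tau>) uh"
  "v \<in> Vh k \<Longrightarrow> inner (d (k - 1) \<sigma>h) v + inner (d k uh) (d k v) + inner v ph = inner f v"
  "q \<in> harmonics Vh d k \<Longrightarrow> inner uh q = 0"
  using sol sol_h by (auto simp: mixed_solution_def)

lemma p_in: "p \<in> cocycles V d k" "p \<in> V k" "p \<in> W k" "p \<in> (coboundaries V d k)\<^sup>\<bottom>"
  using harmonicsD[OF sol_in(3)] by (simp_all add: cocyclesD V_in_W)

lemma ph_in: "ph \<in> cocycles Vh d k" "ph \<in> cocycles V d k" "ph \<in> (coboundaries Vh d k)\<^sup>\<bottom>"
  using sol_in(6) cocycles_Vh_subset by (auto simp: harmonics_def)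

abbreviation "d\<sigma> \<equiv> d (k - 1) \<sigma>"
abbreviation "d\<sigma>h \<equiv> d (k - 1) \<sigma>h"

lemma d\<sigma>_in: "d\<sigma> \<in> coboundaries V d k" "d\<sigma> \<in> cocycles V d k" "d\<sigma> \<in> W k"
proof -
  show *: "d\<sigma> \<in> coboundaries V d k" by (rule coboundariesI[OF sol_in(1)])
  then show **: "d\<sigma> \<in> cocycles V d k" using coboundaries_subset_cocycles by blast
  then show "d\<sigma> \<in> W k" by (simp add: cocyclesD V_in_W)
qed

lemma d\<sigma>h_in: "d\<sigma>h \<in> coboundaries Vh d k" "d\<sigma>h \<in> cocycles V d k"
proof -
  show *: "d\<sigma>h \<in> coboundaries Vh d k" using sol_in(4) by (auto simp: coboundaries_def)
  then show "d\<sigma>h \<in> cocycles V d k" using coboundaries_Vh_subset_cocycles cocycles_Vh_subset by blast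
qed

text \<open>On a discrete coboundary both harmonic terms and both \<open>d u\<close> terms drop out
  of the second equation. Hence \<open>d\<sigma>h\<close> is the orthogonal projection of
  \<open>d\<sigma>\<close> onto the discrete coboundaries.\<close>

lemma d\<sigma>_diff_perp: "d\<sigma> - d\<sigma>h \<in> (coboundaries Vh d k)\<^sup>\<bottom>"
  unfolding mem_orthogonal_comp
proof
  fix b assume b: "b \<in> coboundaries Vh d k"
  then have bZh: "b \<in> cocycles Vh d k" using coboundaries_Vh_subset_cocycles by blast
  then have bV: "b \<in> Vh k" "b \<in> V k" "d k b = 0"
    using cocycles_Vh_subset by (auto simp: cocycles_def)
  have "inner b p = 0" using p_in(4) b coboundaries_Vh_subset by (auto intro: orthogonal_compD)
  moreover have "inner b ph = 0" using ph_in(3) b by (rule orthogonal_compD(2))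
  ultimately show "inner (d\<sigma> - d\<sigma>h) b = 0"
    using sol_eqs(2)[OF bV(2)] sol_eqs(5)[OF bV(1)] bV(3) by (simp add: inner_diff_left)
qed

lemma d\<sigma>_estimate: "norm (d\<sigma> - d\<sigma>h) \<le> M * infdist d\<sigma> (Vh k)"
proof -
  have "d\<sigma>h - \<pi> k d\<sigma> \<in> coboundaries Vh d k"
    by (rule subspace_diff[OF subspace_coboundaries_Vh d\<sigma>h_in(1) d_proj[OF sol_in(1)]])
  then have "inner (d\<sigma> - d\<sigma>h) (d\<sigma>h - \<pi> k d\<sigma>) = 0" by (rule orthogonal_compD(1)[OF d\<sigma>_diff_perp])
  from norm_le_norm_add_if_orthogonal[OF this]
  have "norm (d\<sigma> - d\<sigma>h) \<le> norm (d\<sigma> - \<pi> k d\<sigma>)" by simp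
  also have "\<dots> \<le> M * infdist d\<sigma> (Vh k)" by (rule proj_error_le_infdist) (use d\<sigma>_in in auto)
  finally show ?thesis .
qed

text \<open>The coexact part \<open>s\<close> of \<open>\<sigma>h\<close> is interposed:
  \<open>\<sigma> - s\<close> is coexact and yields to duality, \<open>s - \<sigma>h\<close> is a
  coexactness defect. In \<open>1 + M\<close>, the 1 comes from \<open>e = \<sigma> - s\<close>
  itself and the \<open>M\<close> from \<open>(I - \<pi>) e\<close>.\<close>

lemma \<sigma>_estimate:
  "norm (\<sigma> - \<sigma>h) \<le> M * infdist \<sigma> (Vh (k - 1)) + (1 + M) * (\<eta> * norm (d\<sigma> - d\<sigma>h))"
proof -
  define s where "s = coexact_part (k - 1) \<sigma>h"
  have s: "s \<in> V (k - 1)" "s \<in> (cocycles V d (k - 1))\<^sup>\<bottom>" "d (k - 1) s = d\<sigma>h"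
    unfolding s_def using sol_Vh_in_V(1)
    by (simp_all add: coexact_part_in coexact_part_perp d_coexact_part)
  have \<sigma>perp: "\<sigma> \<in> (cocycles V d (k - 1))\<^sup>\<bottom>"
    using sol_eqs(1) by (simp add: mem_orthogonal_comp cocycles_def)
  have \<sigma>hperp: "\<sigma>h \<in> (cocycles Vh d (k - 1))\<^sup>\<bottom>"
    using sol_eqs(4) by (simp add: mem_orthogonal_comp cocycles_def)
  define e where "e = \<sigma> - s"
  have e: "e \<in> V (k - 1)" "e \<in> (cocycles V d (k - 1))\<^sup>\<bottom>" "d (k - 1) e = d\<sigma> - d\<sigma>h"
    unfolding e_def using sol_in(1) s \<sigma>perp
    by (simp_all add: d_diff subspace_diff[OF subspace_V] subspace_diff[OF subspace_orthogonal_comp])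
  have eW: "e \<in> W (k - 1)" using e(1) by (rule V_in_W)
  define w where "w = K (k - 1) e"
  have w: "w \<in> V (k - 1)" unfolding w_def by (rule solution_op_in[OF eW])
  have "inner e e = inner (d (k - 1) w) (d\<sigma> - d\<sigma>h)"
    using solution_op_coexact(2)[OF eW e(2) e(1)] by (simp add: w_def e(3))
  also have "\<dots> = inner (d (k - 1) w - \<pi> k (d (k - 1) w)) (d\<sigma> - d\<sigma>h)"
    using orthogonal_compD(2)[OF d\<sigma>_diff_perp d_proj[OF w]] by (simp add: inner_diff_left)
  also have "\<dots> \<le> norm (d (k - 1) w - \<pi> k (d (k - 1) w)) * norm (d\<sigma> - d\<sigma>h)"
    by (rule norm_cauchy_schwarz)
  also have "\<dots> \<le> (\<eta> * norm e) * norm (d\<sigma> - d\<sigma>h)"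
    using d_solution_op_error[OF _ eW] by (intro mult_right_mono) (simp_all add: w_def)
  finally have "inner e e \<le> (\<eta> * norm (d\<sigma> - d\<sigma>h)) * norm e" by (simp add: mult_ac)
  then have e_le: "norm e \<le> \<eta> * norm (d\<sigma> - d\<sigma>h)"
    using eta_nonneg by (intro norm_le_if_inner_le) auto
  have \<sigma>W: "\<sigma> \<in> W (k - 1)" using sol_in(1) by (rule V_in_W)
  \<comment> \<open>The bound with \<eta> would leave \<open>norm d\<sigma>h\<close>, which is not
    an error. Keeping \<open>(I - \<pi>) s\<close> and writing \<open>s = \<sigma> - e\<close> gives
    errors only.\<close>
  have "norm (\<sigma>h - s) \<le> norm (s - \<pi> (k - 1) s)"
    unfolding s_def by (rule discrete_coexact_error(1)[OF sol_in(4) \<sigma>hperp])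
  also have "s - \<pi> (k - 1) s = (\<sigma> - \<pi> (k - 1) \<sigma>) - (e - \<pi> (k - 1) e)"
    using \<sigma>W V_in_W[OF s(1)] by (simp add: e_def proj_diff)
  also have "norm \<dots> \<le> norm (\<sigma> - \<pi> (k - 1) \<sigma>) + norm (e - \<pi> (k - 1) e)"
    by (rule norm_triangle_ineq4)
  also have "\<dots> \<le> M * infdist \<sigma> (Vh (k - 1)) + M * norm e"
    using \<sigma>W eW by (intro add_mono proj_error_le_infdist proj_bound) auto
  finally have "norm (s - \<sigma>h) \<le> M * infdist \<sigma> (Vh (k - 1)) + M * norm e"
    by (simp add: norm_minus_commute)
  then have "norm (\<sigma> - \<sigma>h) \<le> M * infdist \<sigma> (Vh (k - 1)) + (1 + M) * norm e"
    using norm_triangle_ineq[of e "s - \<sigma>h"] by (simp add: e_def distrib_right)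
  also have "\<dots> \<le> M * infdist \<sigma> (Vh (k - 1)) + (1 + M) * (\<eta> * norm (d\<sigma> - d\<sigma>h))"
    using e_le M_pos by (intro add_left_mono mult_left_mono) auto
  finally show ?thesis .
qed

text \<open>\<open>z\<close> is at least as close to \<open>p\<close> as the discrete cocycle
  \<open>\<pi> k p\<close>. The remainder \<open>q = ph - z\<close> is discretely harmonic, and it
  sees \<open>d\<sigma> - d\<sigma>h\<close> only through \<open>q - PH q\<close>, because that
  difference is exact.\<close>

lemma p_estimate: "norm (p - ph) \<le> M * infdist p (Vh k) + \<mu> * norm (d\<sigma> - d\<sigma>h)"
proof -
  define z where "z = orth_proj (cocycles Vh d k) p"
  have z: "z \<in> cocycles Vh d k" "p - z \<in> (cocycles Vh d k)\<^sup>\<bottom>"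
    unfolding z_def by (rule orth_proj_cocycles_Vh)+
  have d\<pi>p: "d k (\<pi> k p) = 0"
    using proj_d[OF p_in(2)] cocyclesD(2)[OF p_in(1)] lin_on_0[OF proj_linear subspace_W] by simp
  then have "\<pi> k p \<in> cocycles Vh d k" using proj_in[OF p_in(3)] by (simp add: cocycles_def)
  then have "inner (p - z) (z - \<pi> k p) = 0"
    using z by (intro orthogonal_compD(1)[OF z(2)] subspace_diff[OF subspace_cocycles_Vh])
  from norm_le_norm_add_if_orthogonal[OF this]
  have "norm (p - z) \<le> norm (p - \<pi> k p)" by simp
  also have "\<dots> \<le> M * infdist p (Vh k)" by (rule proj_error_le_infdist) (use p_in in auto)
  finally have pz: "norm (p - z) \<le> M * infdist p (Vh k)" .
  define q where "q = ph - z"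
  have "p \<in> (coboundaries Vh d k)\<^sup>\<bottom>"
    using p_in(4) coboundaries_Vh_subset by (auto simp: mem_orthogonal_comp)
  moreover have "p - z \<in> (coboundaries Vh d k)\<^sup>\<bottom>"
    using z(2) coboundaries_Vh_subset_cocycles by (auto simp: mem_orthogonal_comp)
  ultimately have "p - (p - z) \<in> (coboundaries Vh d k)\<^sup>\<bottom>"
    by (rule subspace_diff[OF subspace_orthogonal_comp])
  then have "q \<in> (coboundaries Vh d k)\<^sup>\<bottom>"
    unfolding q_def using ph_in(3) by (simp add: subspace_diff[OF subspace_orthogonal_comp])
  moreover have qZh: "q \<in> cocycles Vh d k"
    unfolding q_def by (rule subspace_diff[OF subspace_cocycles_Vh ph_in(1) z(1)])
  ultimately have qH: "q \<in> harmonics Vh d k" by (simp add: harmonics_def)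
  note q = discrete_harmonic_error[OF qH]
  have qV: "q \<in> Vh k" "q \<in> V k" "d k q = 0"
    using qZh cocycles_Vh_subset by (auto simp: cocycles_def)
  have d\<sigma>h_q: "inner d\<sigma>h q = 0"
    using orthogonal_compD(2)[OF _ d\<sigma>h_in(1)] \<open>q \<in> (coboundaries Vh d k)\<^sup>\<bottom>\<close> by blast
  have "inner (ph - p) q = inner d\<sigma> q"
    using sol_eqs(2)[OF qV(2)] sol_eqs(5)[OF qV(1)] d\<sigma>h_q qV(3)
    by (simp add: inner_simps inner_commute)
  moreover have "inner (p - z) q = 0" by (rule orthogonal_compD(1)[OF z(2) qZh])
  ultimately have "inner q q = inner (d\<sigma> - d\<sigma>h) q"
    using d\<sigma>h_q by (simp add: q_def inner_diff_left)
  also have "\<dots> = inner (d\<sigma> - d\<sigma>h) (q - PH q)"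
  proof -
    have "d\<sigma> - d\<sigma>h \<in> coboundaries V d k"
      using d\<sigma>_in(1) d\<sigma>h_in(1) coboundaries_Vh_subset
      by (intro subspace_diff[OF subspace_coboundaries]) auto
    then have "inner (d\<sigma> - d\<sigma>h) (PH q) = 0"
      using orth_proj_in[OF subspace_harmonics complete_harmonics] harmonicsD(2) orthogonal_compD(2)
      by blast
    then show ?thesis by (simp add: inner_diff_right)
  qed
  also have "\<dots> \<le> norm (d\<sigma> - d\<sigma>h) * norm (q - PH q)" by (rule norm_cauchy_schwarz)
  also have "\<dots> \<le> norm (d\<sigma> - d\<sigma>h) * (\<mu> * norm q)" using q(2) by (rule mult_left_mono) simp
  finally have "inner q q \<le> (\<mu> * norm (d\<sigma> - d\<sigma>h)) * norm q" by (simp add: mult_ac)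
  then have "norm q \<le> \<mu> * norm (d\<sigma> - d\<sigma>h)" using mu_nonneg by (intro norm_le_if_inner_le) auto
  then show ?thesis
    using pz norm_triangle_ineq4[of "p - z" q] by (simp add: q_def)
qed

section \<open>Errors of \<open>d u\<close> and \<open>u\<close>\<close>

abbreviation "R \<equiv> (d\<sigma> - d\<sigma>h) + (p - ph)"

text \<open>\<open>R\<close> is the failure of Galerkin orthogonality for \<open>u\<close>. Being a
  cocycle, it is invisible to coexact fields, so it acts only through defects.\<close>

lemma residual_cocycle: "R \<in> cocycles V d k"
  using d\<sigma>_in(2) d\<sigma>h_in(2) p_in(1) ph_in(2)
  by (intro subspace_add[OF subspace_cocycles] subspace_diff[OF subspace_cocycles])

lemma residual_eq:
  assumes "v \<in> Vh k"
  shows "inner (d k u - d k uh) (d k v) = - inner R v"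
  using sol_eqs(2)[OF Vh_in[OF assms]] sol_eqs(5)[OF assms]
  by (simp add: inner_simps inner_commute)

text \<open>Only a discrete field has a discrete Hodge decomposition, so this vector is split rather
  than \<open>u - uh\<close>. Its coexact, exact and harmonic components are
  \<open>e - e\<^sub>Z\<close>, \<open>e\<^sub>B\<close> and
  \<open>e\<^sub>Z - e\<^sub>B\<close>.\<close>

abbreviation "e \<equiv> \<pi> k u - uh"
abbreviation "e\<^sub>Z \<equiv> orth_proj (cocycles Vh d k) e"
abbreviation "e\<^sub>B \<equiv> orth_proj (coboundaries Vh d k) e"

lemma u_in_W: "u \<in> W k"
  using sol_in(2) by (rule V_in_W)

lemma e_in: "e \<in> Vh k"
  using proj_in[OF u_in_W] sol_in(5) by (rule subspace_diff[OF subspace_Vh])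

lemma u_proj_estimate: "norm (u - \<pi> k u) \<le> M * infdist u (Vh k)"
  by (rule proj_error_le_infdist) (simp_all add: u_in_W)

lemma coexact_error:
  shows coexact_error_in: "e - e\<^sub>Z \<in> Vh k" "e - e\<^sub>Z \<in> (cocycles Vh d k)\<^sup>\<bottom>"
    and d_coexact_error: "d k (e - e\<^sub>Z) = \<pi> (k + 1) (d k u) - d k uh"
proof -
  note Z = orth_proj_cocycles_Vh[where j = k and x = e]
  show "e - e\<^sub>Z \<in> Vh k"
    using e_in cocycles_Vh_in[OF Z(1)] by (rule subspace_diff[OF subspace_Vh])
  show "e - e\<^sub>Z \<in> (cocycles Vh d k)\<^sup>\<bottom>" by (rule Z(2))
  have "d k (e - e\<^sub>Z) = d k e"
    using Z(1) cocycles_Vh_subset e_in by (auto simp: d_diff Vh_in cocyclesD subset_iff)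
  also have "\<dots> = \<pi> (k + 1) (d k u) - d k uh"
    using proj_in[OF u_in_W] sol_in by (simp add: d_diff Vh_in proj_d)
  finally show "d k (e - e\<^sub>Z) = \<pi> (k + 1) (d k u) - d k uh" .
qed

text \<open>The error equation is tested with \<open>vh\<close> itself. The residual sees only the
  defect \<open>vh - v\<close>, which costs \<eta>; the other term pays for replacing
  \<open>d k u\<close> by its projection.\<close>

lemma d_coexact_error_estimate:
  "norm (d k (e - e\<^sub>Z)) \<le> M * infdist (d k u) (Vh (k + 1)) + \<eta> * norm R"
proof -
  define vh where "vh = e - e\<^sub>Z"
  have vh: "vh \<in> Vh k" "vh \<in> (cocycles Vh d k)\<^sup>\<bottom>" "d k vh = \<pi> (k + 1) (d k u) - d k uh"
    unfolding vh_def by (rule coexact_error)+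
  define v where "v = coexact_part k vh"
  have vh_v: "norm (vh - v) \<le> \<eta> * norm (d k vh)"
    unfolding v_def by (rule discrete_coexact_error(2)[OF vh(1,2)]) simp
  have "inner (d k u - d k uh) (d k vh) = - inner R (vh - v)"
    using residual_eq[OF vh(1)] orthogonal_compD(2)[OF coexact_part_perp residual_cocycle, of vh]
    by (simp add: v_def inner_diff_right)
  also have "\<dots> \<le> norm R * norm (vh - v)" using norm_cauchy_schwarz[of "- R" "vh - v"] unfolding inner_minus_left norm_minus_cancel .
  also have "\<dots> \<le> norm R * (\<eta> * norm (d k vh))" using vh_v by (rule mult_left_mono) simp
  finally have 1: "inner (d k u - d k uh) (d k vh) \<le> (\<eta> * norm R) * norm (d k vh)"
    by (simp add: mult_ac)
  have duW: "d k u \<in> W (k + 1)" by (rule d_in_W[OF sol_in(2)])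
  have "inner (\<pi> (k + 1) (d k u) - d k u) (d k vh)
      \<le> norm (\<pi> (k + 1) (d k u) - d k u) * norm (d k vh)"
    by (rule norm_cauchy_schwarz)
  also have "\<dots> \<le> (M * infdist (d k u) (Vh (k + 1))) * norm (d k vh)"
    using proj_error_le_infdist[OF _ duW] by (intro mult_right_mono) (simp_all add: norm_minus_commute)
  finally have "inner (d k vh) (d k vh) \<le> (M * infdist (d k u) (Vh (k + 1)) + \<eta> * norm R) * norm (d k vh)"
    using 1 by (simp add: vh(3) inner_diff_left distrib_right)
  then show ?thesis
    unfolding vh_def[symmetric] using M_pos eta_nonneg
    by (intro norm_le_if_inner_le) (auto intro!: add_nonneg_nonneg mult_nonneg_nonneg infdist_nonneg)
qed

lemma du_estimate:
  "norm (d k u - d k uh) \<le> 2 * (M * infdist (d k u) (Vh (k + 1))) + \<eta> * norm R"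
proof -
  have "norm (d k u - \<pi> (k + 1) (d k u)) \<le> M * infdist (d k u) (Vh (k + 1))"
    by (rule proj_error_le_infdist) (simp_all add: d_in_W[OF sol_in(2)])
  then show ?thesis
    using d_coexact_error_estimate
      norm_triangle_ineq[of "d k u - \<pi> (k + 1) (d k u)" "d k (e - e\<^sub>Z)"]
    by (simp add: d_coexact_error)
qed

text \<open>Aubin-Nitsche duality with \<open>w = K t\<close>, where \<open>d* d w = t\<close>
  weakly. Subtracting the test function \<open>\<pi> k w\<close> produces \<eta> against
  \<open>d(u - uh)\<close> and, since \<open>R\<close> is orthogonal to \<open>w\<close>, \<delta>
  against \<open>R\<close>.\<close>

lemma coexact_part_error_estimate:
  "norm (coexact_part k (u - uh)) \<le> \<eta> * norm (d k u - d k uh) + \<delta> * norm R"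
proof -
  define t where "t = coexact_part k (u - uh)"
  have uV: "u - uh \<in> V k" using sol_in(2) sol_Vh_in_V(2) by (rule subspace_diff[OF subspace_V])
  have t: "t \<in> V k" "t \<in> (cocycles V d k)\<^sup>\<bottom>" "d k t = d k u - d k uh"
    unfolding t_def using uV sol_in(2) sol_Vh_in_V(2)
    by (simp_all add: coexact_part_in coexact_part_perp d_coexact_part d_diff)
  have tW: "t \<in> W k" using t(1) by (rule V_in_W)
  define w where "w = K k t"
  have w: "w \<in> V k" "w \<in> (cocycles V d k)\<^sup>\<bottom>"
    unfolding w_def using solution_op_in(1)[OF tW] solution_op_coexact(1)[OF tW t(2)] by simp_all
  have "inner t t = inner (d k w) (d k u - d k uh)"
    using solution_op_coexact(2)[OF tW t(2) t(1)] by (simp add: w_def t(3))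
  also have "\<dots> = inner (d k w - \<pi> (k + 1) (d k w)) (d k u - d k uh) + inner R (w - \<pi> k w)"
  proof -
    have "inner R (w - \<pi> k w) = inner (d k u - d k uh) (d k (\<pi> k w))"
      using residual_eq[OF proj_in[OF V_in_W[OF w(1)]]]
        orthogonal_compD(2)[OF w(2) residual_cocycle]
      unfolding inner_diff_right[of R] by linarith
    then show ?thesis
      unfolding proj_d[OF w(1)] inner_diff_left[of "d k w"]
      by (simp add: inner_commute[of "\<pi> (k + 1) (d k w)"])
  qed
  also have "\<dots> \<le> norm (d k w - \<pi> (k + 1) (d k w)) * norm (d k u - d k uh) + norm R * norm (w - \<pi> k w)"
    by (intro add_mono norm_cauchy_schwarz)
  also have "\<dots> \<le> (\<eta> * norm t) * norm (d k u - d k uh) + norm R * (\<delta> * norm t)"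
    using d_solution_op_error[OF _ tW] solution_op_error(1)[OF tW]
    by (intro add_mono mult_left_mono mult_right_mono) (simp_all add: w_def)
  finally have "inner t t \<le> (\<eta> * norm (d k u - d k uh) + \<delta> * norm R) * norm t"
    by (simp add: algebra_simps)
  then show ?thesis
    unfolding t_def[symmetric] using eta_nonneg delta_nonneg
    by (intro norm_le_if_inner_le) auto
qed

text \<open>Removing \<open>e\<^sub>Z\<close> does not change the coexact part, and
  \<open>e = (u - uh) - (u - \<pi> k u)\<close>. So the coexact part of \<open>e - e\<^sub>Z\<close>
  is a difference of two coexact parts, and the rest is a defect.\<close>

lemma coexact_error_estimate:
  "norm (e - e\<^sub>Z) \<le> \<eta> * norm (d k (e - e\<^sub>Z)) + norm (coexact_part k (u - uh)) + norm (u - \<pi> k u)"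
proof -
  define vh where "vh = e - e\<^sub>Z"
  have vh: "vh \<in> Vh k" "vh \<in> (cocycles Vh d k)\<^sup>\<bottom>" "d k vh = \<pi> (k + 1) (d k u) - d k uh"
    unfolding vh_def by (rule coexact_error)+
  define v where "v = coexact_part k vh"
  have 1: "norm (vh - v) \<le> \<eta> * norm (d k vh)"
    unfolding v_def by (rule discrete_coexact_error(2)[OF vh(1,2)]) simp
  have \<pi>uV: "\<pi> k u \<in> V k" by (rule Vh_in[OF proj_in[OF u_in_W]])
  have uV: "u - uh \<in> V k" "u - \<pi> k u \<in> V k"
    using sol_in(2) sol_Vh_in_V(2) \<pi>uV by (simp_all add: subspace_diff[OF subspace_V])
  have "v = coexact_part k (u - uh) - coexact_part k (u - \<pi> k u)"
  proof (rule perp_cocycles_unique)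
    show "d k v = d k (coexact_part k (u - uh) - coexact_part k (u - \<pi> k u))"
      using vh uV \<pi>uV sol_in(2) sol_Vh_in_V(2)
      by (simp add: v_def d_coexact_part Vh_in d_diff coexact_part_in proj_d)
  qed (use vh(1) uV in \<open>simp_all add: v_def coexact_part_in coexact_part_perp Vh_in
      subspace_diff[OF subspace_V] subspace_diff[OF subspace_orthogonal_comp]\<close>)
  then have "norm v \<le> norm (coexact_part k (u - uh)) + norm (u - \<pi> k u)"
    using norm_triangle_ineq4[of "coexact_part k (u - uh)" "coexact_part k (u - \<pi> k u)"]
      norm_coexact_part_le[of k "u - \<pi> k u"] by simp
  then show ?thesis
    unfolding vh_def[symmetric] using 1 norm_triangle_ineq[of "vh - v" v] by simp
qed

text \<open>Exact fields are reached through the first equation: writing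
  \<open>b = d \<tau>h\<close> turns \<open><u - uh, b>\<close> into
  \<open><\<sigma> - \<sigma>h, \<tau>h>\<close>. Passing from \<open>\<tau>h\<close> to its coexact
  part \<tau> costs \<eta>; then \<open>\<tau> = d* K b\<close> moves the derivative onto
  \<open>\<sigma> - \<sigma>h\<close>.\<close>

lemma exact_error_estimate:
  "norm e\<^sub>B \<le> norm (u - \<pi> k u) + \<eta> * norm (\<sigma> - \<sigma>h) + \<delta> * norm (d\<sigma> - d\<sigma>h)"
proof -
  define b where "b = e\<^sub>B"
  have b: "b \<in> coboundaries Vh d k" "e - b \<in> (coboundaries Vh d k)\<^sup>\<bottom>"
    unfolding b_def by (rule orth_proj_coboundaries_Vh)+
  have bB: "b \<in> coboundaries V d k" using b(1) coboundaries_Vh_subset by blast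
  then have bW: "b \<in> W k"
    using coboundaries_subset_cocycles by (auto dest: cocyclesD(1) V_in_W)
  obtain \<tau>0 where \<tau>0: "\<tau>0 \<in> Vh (k - 1)" "d (k - 1) \<tau>0 = b" using b(1) by (auto simp: coboundaries_def)
  \<comment> \<open>A discretely coexact potential, as \<open>discrete_coexact_error\<close>
    requires.\<close>
  define \<tau>h where "\<tau>h = \<tau>0 - orth_proj (cocycles Vh d (k - 1)) \<tau>0"
  note Z = orth_proj_cocycles_Vh[where j = "k - 1" and x = \<tau>0]
  have "orth_proj (cocycles Vh d (k - 1)) \<tau>0 \<in> cocycles V d (k - 1)"
    using Z(1) cocycles_Vh_subset by blast
  then have \<tau>h: "\<tau>h \<in> Vh (k - 1)" "\<tau>h \<in> (cocycles Vh d (k - 1))\<^sup>\<bottom>" "d (k - 1) \<tau>h = b"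
    unfolding \<tau>h_def using Z \<tau>0 cocycles_Vh_in[OF Z(1)]
    by (simp_all add: subspace_diff[OF subspace_Vh] d_diff Vh_in cocyclesD)
  define \<tau> where "\<tau> = coexact_part (k - 1) \<tau>h"
  have \<tau>: "\<tau> \<in> V (k - 1)" "\<tau> \<in> (cocycles V d (k - 1))\<^sup>\<bottom>" "d (k - 1) \<tau> = b"
    unfolding \<tau>_def using Vh_in[OF \<tau>h(1)] \<tau>h(3)
    by (simp_all add: coexact_part_in coexact_part_perp d_coexact_part)
  have \<tau>_err: "norm (\<tau>h - \<tau>) \<le> \<eta> * norm b"
    unfolding \<tau>_def using discrete_coexact_error(2)[OF \<tau>h(1,2)] \<tau>h(3) by simp
  have \<tau>_eq: "\<tau> = adj W V d k (K k b)"
    using \<tau> solution_op_coboundary(2,3)[OF bB] solution_op_in(2)[OF bW]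
    by (metis perp_cocycles_unique)
  have \<sigma>\<sigma>: "\<sigma> - \<sigma>h \<in> V (k - 1)"
    using sol_in(1) sol_Vh_in_V(1) by (rule subspace_diff[OF subspace_V])
  \<comment> \<open>Exactness of \<open>K k b\<close> makes its projection a discrete coboundary, to
    which \<open>d\<sigma> - d\<sigma>h\<close> is orthogonal; this is the source of
    \<delta>.\<close>
  obtain s where s: "s \<in> V (k - 1)" "K k b = d (k - 1) s"
    using solution_op_coboundary(1)[OF bB] by (auto simp: coboundaries_def)
  have "inner (\<sigma> - \<sigma>h) \<tau> = inner (d\<sigma> - d\<sigma>h) (K k b)"
    using solution_op_coboundary(4)[OF bB \<sigma>\<sigma>] sol_in(1) sol_Vh_in_V(1)
    by (simp add: \<tau>_eq inner_commute d_diff)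
  also have "\<dots> = inner (d\<sigma> - d\<sigma>h) (K k b - \<pi> k (K k b))"
    using orthogonal_compD(1)[OF d\<sigma>_diff_perp d_proj[OF s(1)]] by (simp add: s(2) inner_diff_right)
  also have "\<dots> \<le> norm (d\<sigma> - d\<sigma>h) * norm (K k b - \<pi> k (K k b))" by (rule norm_cauchy_schwarz)
  also have "\<dots> \<le> norm (d\<sigma> - d\<sigma>h) * (\<delta> * norm b)"
    using solution_op_error(1)[OF bW] by (rule mult_left_mono) simp
  finally have 1: "inner (\<sigma> - \<sigma>h) \<tau> \<le> (\<delta> * norm (d\<sigma> - d\<sigma>h)) * norm b" by (simp add: mult_ac)
  have "inner (\<sigma> - \<sigma>h) (\<tau>h - \<tau>) \<le> norm (\<sigma> - \<sigma>h) * norm (\<tau>h - \<tau>)" by (rule norm_cauchy_schwarz)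
  also have "\<dots> \<le> norm (\<sigma> - \<sigma>h) * (\<eta> * norm b)" using \<tau>_err by (rule mult_left_mono) simp
  finally have 2: "inner (\<sigma> - \<sigma>h) (\<tau>h - \<tau>) \<le> (\<eta> * norm (\<sigma> - \<sigma>h)) * norm b" by (simp add: mult_ac)
  have 3: "inner (\<pi> k u - u) b \<le> norm (u - \<pi> k u) * norm b"
    using norm_cauchy_schwarz[of "\<pi> k u - u" b] by (simp add: norm_minus_commute)
  have "inner b b = inner e b"
    using orthogonal_compD(1)[OF b(2,1)] by (simp add: inner_diff_left)
  also have "\<dots> = inner (\<pi> k u - u) b + (inner (\<sigma> - \<sigma>h) (\<tau>h - \<tau>) + inner (\<sigma> - \<sigma>h) \<tau>)"
    using sol_eqs(1)[OF Vh_in[OF \<tau>h(1)]] sol_eqs(4)[OF \<tau>h(1)]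
    by (simp add: \<tau>h(3) inner_diff_left inner_diff_right inner_commute)
  finally have "inner b b \<le> (norm (u - \<pi> k u) + \<eta> * norm (\<sigma> - \<sigma>h) + \<delta> * norm (d\<sigma> - d\<sigma>h)) * norm b"
    using 1 2 3 by (simp add: distrib_right)
  then show ?thesis
    unfolding b_def[symmetric] using eta_nonneg delta_nonneg by (intro norm_le_if_inner_le) auto
qed

abbreviation "PBu \<equiv> orth_proj (coboundaries V d k) u"

text \<open>A discrete harmonic \<open>q\<close> is orthogonal to \<open>uh\<close> but perhaps not
  to \<open>u\<close>. Against the cocycle \<open>q\<close>, \<open>u\<close> reduces to
  \<open>PBu\<close>; then both factors shrink to defects, \<open>PBu\<close> because
  \<open>q\<close> is orthogonal to discrete coboundaries and \<open>q\<close> because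
  \<open>PBu - \<pi> k PBu\<close> is exact.\<close>

lemma harmonic_error_estimate:
  "norm (e\<^sub>Z - e\<^sub>B) \<le> norm (u - \<pi> k u) + \<mu> * (M * infdist PBu (Vh k))"
proof -
  define q where "q = e\<^sub>Z - e\<^sub>B"
  note Z = orth_proj_cocycles_Vh[where j = k and x = e] and B = orth_proj_coboundaries_Vh[where j = k and x = e]
  have qZh: "q \<in> cocycles Vh d k"
    unfolding q_def using Z(1) B(1) coboundaries_Vh_subset_cocycles
    by (intro subspace_diff[OF subspace_cocycles_Vh]) auto
  have "e - e\<^sub>Z \<in> (coboundaries Vh d k)\<^sup>\<bottom>"
    using Z(2) coboundaries_Vh_subset_cocycles unfolding mem_orthogonal_comp by blast
  then have "(e - e\<^sub>B) - (e - e\<^sub>Z) \<in> (coboundaries Vh d k)\<^sup>\<bottom>"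
    by (rule subspace_diff[OF subspace_orthogonal_comp B(2)])
  then have qB: "q \<in> (coboundaries Vh d k)\<^sup>\<bottom>" by (simp add: q_def)
  with qZh have qH: "q \<in> harmonics Vh d k" by (simp add: harmonics_def)
  note q = discrete_harmonic_error[OF qH]
  have "q \<in> cocycles V d k" using qZh cocycles_Vh_subset by blast
  note P = orth_proj_complete[OF subspace_coboundaries[of k] complete_coboundaries, of u]
  obtain s where s: "s \<in> V (k - 1)" "PBu = d (k - 1) s" using P(1) by (auto simp: coboundaries_def)
  have PW: "PBu \<in> W k"
    using P(1) coboundaries_subset_cocycles cocyclesD(1) V_in_W by blast
  have "u - PBu \<in> (cocycles V d k)\<^sup>\<bottom>"
  proof (rule perp_cocyclesI[OF P(2)])
    show "u - PBu \<in> (harmonics V d k)\<^sup>\<bottom>"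
      using sol_eqs(3) orthogonal_compD(2)[OF harmonicsD(2) P(1)]
      by (simp add: mem_orthogonal_comp inner_diff_left)
  qed
  then have "inner u q = inner PBu q"
    using orthogonal_compD(1)[OF _ \<open>q \<in> cocycles V d k\<close>, of "u - PBu"] by (simp add: inner_diff_left)
  also have "\<dots> = inner (PBu - \<pi> k PBu) q"
    using orthogonal_compD(2)[OF qB d_proj[OF s(1)]] by (simp add: s(2) inner_diff_left)
  also have "\<dots> = inner (PBu - \<pi> k PBu) (q - PH q)"
  proof -
    have "PBu - \<pi> k PBu \<in> coboundaries V d k"
      using P(1) d_proj[OF s(1)] coboundaries_Vh_subset
      by (intro subspace_diff[OF subspace_coboundaries]) (auto simp: s(2))
    then have "inner (PBu - \<pi> k PBu) (PH q) = 0"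
      using orth_proj_in[OF subspace_harmonics complete_harmonics] harmonicsD(2) orthogonal_compD(2)
      by blast
    then show ?thesis by (simp add: inner_diff_right)
  qed
  also have "\<dots> \<le> norm (PBu - \<pi> k PBu) * norm (q - PH q)" by (rule norm_cauchy_schwarz)
  also have "\<dots> \<le> (M * infdist PBu (Vh k)) * (\<mu> * norm q)"
    using q(2) proj_error_le_infdist[OF _ PW] M_pos
    by (intro mult_mono) (auto intro: mult_nonneg_nonneg infdist_nonneg)
  finally have 1: "inner u q \<le> (\<mu> * (M * infdist PBu (Vh k))) * norm q" by (simp add: mult_ac)
  have 2: "inner (\<pi> k u - u) q \<le> norm (u - \<pi> k u) * norm q"
    using norm_cauchy_schwarz[of "\<pi> k u - u" q] by (simp add: norm_minus_commute)
  have "inner e\<^sub>Z q = inner e q"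
    using orthogonal_compD(1)[OF Z(2) qZh] by (simp add: inner_diff_left)
  moreover have "inner e\<^sub>B q = 0" by (rule orthogonal_compD(2)[OF qB B(1)])
  ultimately have "inner q q = inner e q" by (simp add: q_def inner_diff_left)
  also have "\<dots> = inner (\<pi> k u - u) q + inner u q"
    using sol_eqs(6)[OF qH] by (simp add: inner_diff_left)
  finally have "inner q q \<le> (norm (u - \<pi> k u) + \<mu> * (M * infdist PBu (Vh k))) * norm q"
    using 1 2 by (simp add: distrib_right)
  then show ?thesis
    unfolding q_def[symmetric] using mu_nonneg M_pos
    by (intro norm_le_if_inner_le) (auto intro!: add_nonneg_nonneg mult_nonneg_nonneg infdist_nonneg)
qed

end


section \<open>Assembly of the constants\<close>

lemma error_estimates:
  assumes sol: "mixed_solution V d k f \<sigma> u p" and sol_h: "mixed_solution Vh d k f \<sigma>h uh ph"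
    and C: "4 * M * (1 + M) \<le> C" and M1: "1 \<le> M"
  defines "E \<equiv> \<lambda>j w. infdist w (Vh j)"
  shows "norm (d (k - 1) (\<sigma> - \<sigma>h)) \<le> C * E k (d (k - 1) \<sigma>)"
    and "norm (\<sigma> - \<sigma>h) \<le> C * (E (k - 1) \<sigma> + \<eta> * E k (d (k - 1) \<sigma>))"
    and "norm (p - ph) \<le> C * (E k p + \<mu> * E k (d (k - 1) \<sigma>))"
    and "norm (d k (u - uh)) \<le> C * (E (k + 1) (d k u) + \<eta> * (E k (d (k - 1) \<sigma>) + E k p))"
    and "norm (u - uh) \<le> C * (E k u + \<eta> * (E (k + 1) (d k u) + E (k - 1) \<sigma>)
      + (\<eta>\<^sup>2 + \<delta>) * (E k (d (k - 1) \<sigma>) + E k p)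
      + \<mu> * E k (orth_proj (coboundaries V d k) u))"
proof -
  define A where "A = E k (d (k - 1) \<sigma>)"
  define D where "D = A + E k p"
  define S where "S = E (k - 1) \<sigma>"
  define G where "G = E (k + 1) (d k u)"
  define U where "U = E k u"
  define B where "B = E k (orth_proj (coboundaries V d k) u)"
  have nonneg: "0 \<le> A" "0 \<le> E k p" "0 \<le> S" "0 \<le> G" "0 \<le> U" "0 \<le> B" "A \<le> D" "0 \<le> D"
    by (simp_all add: A_def D_def S_def G_def U_def B_def E_def infdist_nonneg)
  \<comment> \<open>Dominates every coefficient below: \<open>4 * M\<close> for \<open>U\<close>, as
    the projection error of \<open>u\<close> enters four times, and \<open>3 * (M * (1 + M))\<close>
    for \<open>\<eta>\<^sup>2 * D\<close>.\<close>
  define N where "N = 4 * M * (1 + M)"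
  have "1 * M \<le> (1 + M) * M" using M1 by (intro mult_right_mono) auto
  then have N: "4 * M \<le> N" "4 * (M * (1 + M)) = N" "M \<le> N" "0 \<le> N" "N \<le> C"
    using M1 C by (simp_all add: N_def algebra_simps)
  have up: "norm x \<le> C * y" if "norm x \<le> N * y" "0 \<le> y" for x :: 'a and y
    using that mult_right_mono[OF N(5) that(2)] by linarith
  have dd: "d (k - 1) (\<sigma> - \<sigma>h) = d (k - 1) \<sigma> - d (k - 1) \<sigma>h" "d k (u - uh) = d k u - d k uh"
    using sol_in[OF sol sol_h] sol_Vh_in_V[OF sol sol_h] by (simp_all add: d_diff)
  define a where "a = norm (d (k - 1) \<sigma> - d (k - 1) \<sigma>h)"
  define r where "r = norm ((d (k - 1) \<sigma> - d (k - 1) \<sigma>h) + (p - ph))"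
  have a: "a \<le> M * A"
    using d\<sigma>_estimate[OF sol sol_h] by (simp add: a_def A_def E_def)
  have ss: "norm (\<sigma> - \<sigma>h) \<le> M * S + (1 + M) * (\<eta> * (M * A))"
  proof -
    have "norm (\<sigma> - \<sigma>h) \<le> M * S + (1 + M) * (\<eta> * a)"
      using \<sigma>_estimate[OF sol sol_h] by (simp add: a_def S_def E_def)
    also have "\<dots> \<le> M * S + (1 + M) * (\<eta> * (M * A))"
      using a M1 eta_nonneg by (intro add_left_mono mult_left_mono) auto
    finally show ?thesis .
  qed
  have pp: "norm (p - ph) \<le> M * E k p + \<mu> * (M * A)"
    using p_estimate[OF sol sol_h] mult_left_mono[OF a mu_nonneg] by (simp add: a_def E_def)
  have r: "r \<le> M * (1 + M) * D"
  proof -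
    \<comment> \<open>Smallness of \<mu> is given up here, so that the residual is measured by
      \<open>D\<close> alone.\<close>
    have "\<mu> * (M * A) \<le> M * (M * A)" using mu_le nonneg M1 by (intro mult_right_mono) auto
    then have "r \<le> M * A + (M * E k p + M * (M * A))"
      using a pp norm_triangle_ineq[of "d (k - 1) \<sigma> - d (k - 1) \<sigma>h" "p - ph"]
      by (simp add: r_def a_def)
    also have "\<dots> \<le> M * (1 + M) * D"
      using M1 nonneg by (simp add: D_def algebra_simps)
    finally show ?thesis .
  qed
  have \<eta>r: "\<eta> * r \<le> M * (1 + M) * (\<eta> * D)" and \<delta>r: "\<delta> * r \<le> M * (1 + M) * (\<delta> * D)"
    using mult_left_mono[OF r eta_nonneg] mult_left_mono[OF r delta_nonneg] by (simp_all add: mult_ac)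
  show "norm (d (k - 1) (\<sigma> - \<sigma>h)) \<le> C * E k (d (k - 1) \<sigma>)"
    using a mult_right_mono[OF N(3) nonneg(1)] nonneg(1)
    by (intro up) (simp_all add: dd a_def A_def)
  show "norm (\<sigma> - \<sigma>h) \<le> C * (E (k - 1) \<sigma> + \<eta> * E k (d (k - 1) \<sigma>))"
    unfolding S_def[symmetric] A_def[symmetric]
  proof (rule up)
    have "M * S \<le> N * S" using N(3) nonneg(3) by (rule mult_right_mono)
    moreover have "M * (1 + M) * (\<eta> * A) \<le> N * (\<eta> * A)"
      using N M1 nonneg eta_nonneg by (intro mult_right_mono) auto
    ultimately show "norm (\<sigma> - \<sigma>h) \<le> N * (S + \<eta> * A)" using ss by (simp add: algebra_simps)
  qed (use nonneg eta_nonneg in auto)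
  show "norm (p - ph) \<le> C * (E k p + \<mu> * E k (d (k - 1) \<sigma>))"
    unfolding A_def[symmetric]
  proof (rule up)
    have "M * (E k p + \<mu> * A) \<le> N * (E k p + \<mu> * A)"
      using N(3) nonneg mu_nonneg by (intro mult_right_mono) auto
    then show "norm (p - ph) \<le> N * (E k p + \<mu> * A)" using pp by (simp add: algebra_simps)
  qed (use nonneg mu_nonneg in auto)
  have du: "norm (d k u - d k uh) \<le> 2 * M * G + M * (1 + M) * (\<eta> * D)"
    using du_estimate[OF sol sol_h] \<eta>r by (simp add: r_def G_def E_def)
  show "norm (d k (u - uh)) \<le> C * (E (k + 1) (d k u) + \<eta> * (E k (d (k - 1) \<sigma>) + E k p))"
    unfolding A_def[symmetric] G_def[symmetric] D_def[symmetric] dd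
  proof (rule up)
    have "2 * M * G \<le> N * G" using N M1 nonneg by (intro mult_right_mono) auto
    moreover have "M * (1 + M) * (\<eta> * D) \<le> N * (\<eta> * D)"
      using N M1 nonneg eta_nonneg by (intro mult_right_mono) auto
    ultimately show "norm (d k u - d k uh) \<le> N * (G + \<eta> * D)" using du by (simp add: distrib_left)
  qed (use nonneg eta_nonneg in auto)
  define e where "e = \<pi> k u - uh"
  define eZ where "eZ = orth_proj (cocycles Vh d k) e"
  define eB where "eB = orth_proj (coboundaries Vh d k) e"
  define w where "w = norm (u - \<pi> k u)"
  have w: "w \<le> M * U"
    using u_proj_estimate[OF sol sol_h] by (simp add: w_def U_def E_def)
  define x where "x = norm (d k (e - eZ))"
  have x: "x \<le> M * G + M * (1 + M) * (\<eta> * D)"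
    using d_coexact_error_estimate[OF sol sol_h] \<eta>r by (simp add: x_def e_def eZ_def r_def G_def E_def)
  have c: "norm (coexact_part k (u - uh)) \<le> \<eta> * (2 * M * G + M * (1 + M) * (\<eta> * D)) + M * (1 + M) * (\<delta> * D)"
    using coexact_part_error_estimate[OF sol sol_h] \<delta>r mult_left_mono[OF du eta_nonneg]
    unfolding r_def by linarith
  have 1: "norm (e - eZ) \<le> \<eta> * (3 * M * G + 2 * (M * (1 + M)) * (\<eta> * D)) + M * (1 + M) * (\<delta> * D) + M * U"
    using coexact_error_estimate[OF sol sol_h] c w mult_left_mono[OF x eta_nonneg]
    unfolding x_def e_def eZ_def w_def by (simp add: algebra_simps)
  have 2: "norm eB \<le> M * U + \<eta> * (M * S + (1 + M) * (\<eta> * (M * A))) + \<delta> * (M * A)"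
    using exact_error_estimate[OF sol sol_h] w mult_left_mono[OF ss eta_nonneg]
      mult_left_mono[OF a delta_nonneg]
    unfolding e_def eB_def w_def a_def by linarith
  have 3: "norm (eZ - eB) \<le> M * U + \<mu> * (M * B)"
    using harmonic_error_estimate[OF sol sol_h] w
    by (simp add: e_def eB_def eZ_def w_def B_def E_def)
  have "norm ((u - \<pi> k u) + ((e - eZ) + (eB + (eZ - eB))))
      \<le> w + (norm (e - eZ) + (norm eB + norm (eZ - eB)))"
    unfolding w_def by (intro norm_triangle_mono order_refl)
  then have "norm (u - uh) \<le> w + (norm (e - eZ) + (norm eB + norm (eZ - eB)))"
    by (simp add: e_def)
  also have "\<dots> \<le> 4 * M * U + M * (\<eta> * (3 * G + S)) + 2 * (M * (1 + M)) * (\<eta>\<^sup>2 * D)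
      + M * (1 + M) * (\<eta>\<^sup>2 * A) + M * (1 + M) * (\<delta> * D) + M * (\<delta> * A) + M * (\<mu> * B)"
    using w 1 2 3 by (simp add: algebra_simps power2_eq_square)
  also have "\<dots> \<le> N * (U + \<eta> * (G + S) + (\<eta>\<^sup>2 + \<delta>) * D + \<mu> * B)"
  proof -
    have "4 * M * U \<le> N * U" using N nonneg by (intro mult_right_mono) auto
    moreover have "M * (\<eta> * (3 * G + S)) \<le> 4 * M * (\<eta> * (G + S))"
      using M1 eta_nonneg nonneg by (simp add: algebra_simps add_mono)
    moreover have "4 * M * (\<eta> * (G + S)) \<le> N * (\<eta> * (G + S))"
      using N nonneg eta_nonneg by (intro mult_right_mono) auto
    moreover have "M * (1 + M) * (\<eta>\<^sup>2 * A) \<le> M * (1 + M) * (\<eta>\<^sup>2 * D)"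
      using M1 nonneg by (intro mult_left_mono) auto
    moreover have "3 * (M * (1 + M)) * (\<eta>\<^sup>2 * D) \<le> N * (\<eta>\<^sup>2 * D)"
      using N M1 nonneg by (intro mult_right_mono) auto
    moreover have "M * (\<delta> * A) \<le> M * (1 + M) * (\<delta> * D)"
      using M1 nonneg delta_nonneg by (intro mult_mono) auto
    moreover have "2 * (M * (1 + M)) * (\<delta> * D) \<le> N * (\<delta> * D)"
      using N M1 nonneg delta_nonneg by (intro mult_right_mono) auto
    moreover have "M * (\<mu> * B) \<le> N * (\<mu> * B)"
      using N nonneg mu_nonneg by (intro mult_right_mono) auto
    ultimately show ?thesis by (simp add: algebra_simps)
  qed
  finally have le: "norm (u - uh) \<le> N * (U + \<eta> * (G + S) + (\<eta>\<^sup>2 + \<delta>) * D + \<mu> * B)" .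
  have "norm (u - uh) \<le> C * (U + \<eta> * (G + S) + (\<eta>\<^sup>2 + \<delta>) * D + \<mu> * B)"
    using nonneg eta_nonneg delta_nonneg mu_nonneg by (intro up[OF le]) simp
  then show "norm (u - uh) \<le> C * (E k u + \<eta> * (E (k + 1) (d k u) + E (k - 1) \<sigma>)
      + (\<eta>\<^sup>2 + \<delta>) * (E k (d (k - 1) \<sigma>) + E k p)
      + \<mu> * E k (orth_proj (coboundaries V d k) u))"
    by (simp add: U_def G_def S_def D_def A_def B_def)
qed

end

theorem theorem3p11:
  fixes W V :: "int \<Rightarrow> 'a::real_inner set" and d :: "int \<Rightarrow> 'a \<Rightarrow> 'a"
    and Vh :: "'h \<Rightarrow> int \<Rightarrow> 'a set" and \<pi> :: "'h \<Rightarrow> int \<Rightarrow> 'a \<Rightarrow> 'a" and k :: int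
  assumes "closed_hilbert_complex W V d"
    and "compactness_property W V d"
    and "\<And>h. finite_dim_subcomplex V d (Vh h)"
    and "bounded_cochain_projections W V d Vh \<pi>"
  shows "\<exists>C::real. \<forall>h. \<forall>f\<in>W k. \<forall>\<sigma> u p \<sigma>h uh ph.
    mixed_solution V d k f \<sigma> u p \<longrightarrow> mixed_solution (Vh h) d k f \<sigma>h uh ph \<longrightarrow>
    (let E = (\<lambda>j w. infdist w (Vh h j));
         \<delta> = delta W V d (\<pi> h) k; \<mu> = mu W V d (\<pi> h) k; \<eta> = eta W V d (\<pi> h) k;
         d\<sigma> = d (k - 1) \<sigma>; du = d k u;
         PBu = orth_proj (coboundaries V d k) u
     in norm (d (k - 1) (\<sigma> - \<sigma>h)) \<le> C * E k d\<sigma> \<and>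
        norm (\<sigma> - \<sigma>h) \<le> C * (E (k - 1) \<sigma> + \<eta> * E k d\<sigma>) \<and>
        norm (p - ph) \<le> C * (E k p + \<mu> * E k d\<sigma>) \<and>
        norm (d k (u - uh)) \<le> C * (E (k + 1) du + \<eta> * (E k d\<sigma> + E k p)) \<and>
        norm (u - uh) \<le> C * (E k u + \<eta> * (E (k + 1) du + E (k - 1) \<sigma>)
          + (\<eta>\<^sup>2 + \<delta>) * (E k d\<sigma> + E k p) + \<mu> * E k PBu))"
proof -
  interpret compact_hilbert_complex W V d
    using assms(1,2) by (simp add: compact_hilbert_complex_def compact_hilbert_complex_axioms_def)
  note proj = assms(4)[unfolded bounded_cochain_projections_def, rule_format]
  have "\<exists>m. \<forall>h. \<forall>w\<in>W j. norm (\<pi> h j w) \<le> m * norm w" for j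
    using proj[of j] by blast
  then obtain m where m: "\<And>j h w. w \<in> W j \<Longrightarrow> norm (\<pi> h j w) \<le> m j * norm w" by metis
  \<comment> \<open>The 1 pays for the identity in \<open>I - \<pi>\<close> and ensures
    \<open>1 \<le> M\<close>; absolute values are taken because the bounds \<open>m j\<close> may be
    negative.\<close>
  define M where "M = 1 + \<bar>m (k - 1)\<bar> + \<bar>m k\<bar> + \<bar>m (k + 1)\<bar>"
  have M1: "1 \<le> M" by (simp add: M_def)
  have bound: "norm (w - \<pi> h j w) \<le> M * norm w" if "j \<in> {k - 1, k, k + 1}" "w \<in> W j" for h j w
  proof -
    have "1 + m j \<le> M" using that(1) by (auto simp: M_def)
    then have "(1 + m j) * norm w \<le> M * norm w" by (rule mult_right_mono) simp
    then show ?thesis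
      using m[OF that(2), of h] norm_triangle_ineq4[of w "\<pi> h j w"] by (simp add: distrib_right)
  qed
  have disc: "discretized_hilbert_complex W V d (Vh h) (\<pi> h) k M" for h
    using assms(3) proj bound M1 by unfold_locales auto
  show ?thesis
    unfolding Let_def
    by (intro exI[of _ "4 * M * (1 + M)"] allI ballI impI conjI
        discretized_hilbert_complex.error_estimates[OF disc _ _ order_refl M1])
qed

end
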